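(* There is a deterministic algorithm that maintains a maximum matching $M\subseteq E$ in a dynamic bipartite graph $G=(V,E)$ subject to edge updates (insertions and deletions) in $O(|M|^2)$ time per update.
   Context: $M$ denotes the current maximum matching maintained after each update, and $|M|$ its size. *)

theory Defs
  imports Main "HOL-Library.Disjoint_Sets"
begin

section \<open>Graphs and matchings\<close>

text \<open>An undirected simple graph is given by its vertex set and a set of two-element edges.
  Disjointness of the two sides excludes loops.\<close>

definition bipartite :: "'a set \<Rightarrow> 'a set set \<Rightarrow> bool" where
  "bipartite V E \<longleftrightarrow>
     (\<exists>L R. L \<union> R = V \<and> L \<inter> R = {} \<and> (\<forall>e\<in>E. \<exists>x\<in>L. \<exists>y\<in>R. e = {x, y}))"

definition matching :: "'a set set \<Rightarrow> 'a set set \<Rightarrow> bool" where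
  "matching E M \<longleftrightarrow> M \<subseteq> E \<and> disjoint M"

definition maximum_matching :: "'a set set \<Rightarrow> 'a set set \<Rightarrow> bool" where
  "maximum_matching E M \<longleftrightarrow>
     finite M \<and> matching E M \<and> (\<forall>M'. matching E M' \<longrightarrow> finite M' \<and> card M' \<le> card M)"


section \<open>Edge updates\<close>

text \<open>The vertex set is fixed to \<open>{..<n}\<close>. Every edge set is bipartite with respect to some
  bipartition, which may change over time and is never revealed to the algorithm.\<close>

datatype update = Insert nat nat | Delete nat nat

primrec apply_update :: "update \<Rightarrow> nat set set \<Rightarrow> nat set set" where
  "apply_update (Insert u v) E = insert {u, v} E"
| "apply_update (Delete u v) E = E - {{u, v}}"

definition graph_after :: "update list \<Rightarrow> nat set set" where
  "graph_after us = fold apply_update us {}"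

primrec admissible :: "nat set set \<Rightarrow> update \<Rightarrow> bool" where
  "admissible E (Insert u v) \<longleftrightarrow> {u, v} \<notin> E"
| "admissible E (Delete u v) \<longleftrightarrow> {u, v} \<in> E"

definition bipartite_updates :: "nat \<Rightarrow> update list \<Rightarrow> bool" where
  "bipartite_updates n us \<longleftrightarrow>
     (\<forall>i<length us. admissible (graph_after (take i us)) (us ! i) \<and>
        bipartite {..<n} (graph_after (take (Suc i) us)))"


section \<open>A deterministic word RAM\<close>

text \<open>
  Algorithms are programs of a small imperative language over natural-number variables and
  arrays. A program mentions finitely many of either, so it is a random access machine with a
  fixed number of registers and an addressable memory. Every syntax node that is evaluated or
  executed costs one time unit. The only arithmetic is addition, truncated subtraction and
  multiplication, and every value that occurs in an execution, including intermediate results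
  and array indices, has to be smaller than the word bound \<open>W\<close>; a computation exceeding it
  is stuck.
\<close>

type_synonym name = string

record state =
  var :: "name \<Rightarrow> nat"
  arr :: "name \<Rightarrow> nat \<Rightarrow> nat"

datatype aexp =
    Const nat | Var name | Get name aexp
  | Plus aexp aexp | Minus aexp aexp | Times aexp aexp

datatype bexp = Less aexp aexp | Equal aexp aexp | Neg bexp | Conj bexp bexp

datatype com =
    Skip
  | Assign name aexp
  | Write name aexp aexp  \<comment> \<open>array, index, value\<close>
  | Seq com com
  | Cond bexp com com
  | While bexp com

primrec aval :: "aexp \<Rightarrow> state \<Rightarrow> nat" where
  "aval (Const k) s = k"
| "aval (Var x) s = var s x"
| "aval (Get a i) s = arr s a (aval i s)"
| "aval (Plus a b) s = aval a s + aval b s"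
| "aval (Minus a b) s = aval a s - aval b s"
| "aval (Times a b) s = aval a s * aval b s"

primrec bval :: "bexp \<Rightarrow> state \<Rightarrow> bool" where
  "bval (Less a b) s \<longleftrightarrow> aval a s < aval b s"
| "bval (Equal a b) s \<longleftrightarrow> aval a s = aval b s"
| "bval (Neg b) s \<longleftrightarrow> \<not> bval b s"
| "bval (Conj a b) s \<longleftrightarrow> bval a s \<and> bval b s"

primrec acost :: "aexp \<Rightarrow> nat" where
  "acost (Const k) = 1"
| "acost (Var x) = 1"
| "acost (Get a i) = 1 + acost i"
| "acost (Plus a b) = 1 + acost a + acost b"
| "acost (Minus a b) = 1 + acost a + acost b"
| "acost (Times a b) = 1 + acost a + acost b"

primrec bcost :: "bexp \<Rightarrow> nat" where
  "bcost (Less a b) = 1 + acost a + acost b"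
| "bcost (Equal a b) = 1 + acost a + acost b"
| "bcost (Neg b) = 1 + bcost b"
| "bcost (Conj a b) = 1 + bcost a + bcost b"

primrec afits :: "nat \<Rightarrow> aexp \<Rightarrow> state \<Rightarrow> bool" where
  "afits W (Const k) s \<longleftrightarrow> k < W"
| "afits W (Var x) s \<longleftrightarrow> var s x < W"
| "afits W (Get a i) s \<longleftrightarrow> afits W i s \<and> arr s a (aval i s) < W"
| "afits W (Plus a b) s \<longleftrightarrow> afits W a s \<and> afits W b s \<and> aval a s + aval b s < W"
| "afits W (Minus a b) s \<longleftrightarrow> afits W a s \<and> afits W b s"
| "afits W (Times a b) s \<longleftrightarrow> afits W a s \<and> afits W b s \<and> aval a s * aval b s < W"

primrec bfits :: "nat \<Rightarrow> bexp \<Rightarrow> state \<Rightarrow> bool" where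
  "bfits W (Less a b) s \<longleftrightarrow> afits W a s \<and> afits W b s"
| "bfits W (Equal a b) s \<longleftrightarrow> afits W a s \<and> afits W b s"
| "bfits W (Neg b) s \<longleftrightarrow> bfits W b s"
| "bfits W (Conj a b) s \<longleftrightarrow> bfits W a s \<and> bfits W b s"

definition set_var :: "name \<Rightarrow> nat \<Rightarrow> state \<Rightarrow> state" where
  "set_var x k s = s\<lparr>var := (var s)(x := k)\<rparr>"

definition set_arr :: "name \<Rightarrow> nat \<Rightarrow> nat \<Rightarrow> state \<Rightarrow> state" where
  "set_arr a i k s = s\<lparr>arr := (arr s)(a := (arr s a)(i := k))\<rparr>"

text \<open>\<open>exec W c s t s'\<close>: with word bound \<open>W\<close>, program \<open>c\<close> started in state \<open>s\<close> halts in
  state \<open>s'\<close> after exactly \<open>t\<close> time units.\<close>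

inductive exec :: "nat \<Rightarrow> com \<Rightarrow> state \<Rightarrow> nat \<Rightarrow> state \<Rightarrow> bool" for W :: nat where
  Skip: "exec W Skip s 1 s"
| Assign: "afits W a s \<Longrightarrow> exec W (Assign x a) s (1 + acost a) (set_var x (aval a s) s)"
| Write: "afits W i s \<Longrightarrow> afits W a s \<Longrightarrow>
    exec W (Write x i a) s (1 + acost i + acost a) (set_arr x (aval i s) (aval a s) s)"
| Seq: "exec W c\<^sub>1 s\<^sub>1 t\<^sub>1 s\<^sub>2 \<Longrightarrow> exec W c\<^sub>2 s\<^sub>2 t\<^sub>2 s\<^sub>3 \<Longrightarrow>
    exec W (Seq c\<^sub>1 c\<^sub>2) s\<^sub>1 (1 + t\<^sub>1 + t\<^sub>2) s\<^sub>3"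
| Cond_True: "bfits W b s \<Longrightarrow> bval b s \<Longrightarrow> exec W c\<^sub>1 s t s' \<Longrightarrow>
    exec W (Cond b c\<^sub>1 c\<^sub>2) s (1 + bcost b + t) s'"
| Cond_False: "bfits W b s \<Longrightarrow> \<not> bval b s \<Longrightarrow> exec W c\<^sub>2 s t s' \<Longrightarrow>
    exec W (Cond b c\<^sub>1 c\<^sub>2) s (1 + bcost b + t) s'"
| While_False: "bfits W b s \<Longrightarrow> \<not> bval b s \<Longrightarrow> exec W (While b c) s (1 + bcost b) s"
| While_True: "bfits W b s\<^sub>1 \<Longrightarrow> bval b s\<^sub>1 \<Longrightarrow> exec W c s\<^sub>1 t\<^sub>1 s\<^sub>2 \<Longrightarrow>
    exec W (While b c) s\<^sub>2 t\<^sub>2 s\<^sub>3 \<Longrightarrow> exec W (While b c) s\<^sub>1 (1 + bcost b + t\<^sub>1 + t\<^sub>2) s\<^sub>3"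


lemma exec_deterministic:
  "exec W c s t s' \<Longrightarrow> exec W c s u s'' \<Longrightarrow> t = u \<and> s' = s''"
proof (induction arbitrary: u s'' rule: exec.induct)
  case (Skip s)
  from Skip.prems show ?case by cases simp
next
  case (Assign a s x)
  from Assign.prems show ?case by cases simp
next
  case (Write i s a x)
  from Write.prems show ?case by cases simp
next
  case (Seq c\<^sub>1 s\<^sub>1 t\<^sub>1 s\<^sub>2 c\<^sub>2 t\<^sub>2 s\<^sub>3)
  from Seq.prems obtain u\<^sub>1 r u\<^sub>2 where u: "u = 1 + u\<^sub>1 + u\<^sub>2"
    and r: "exec W c\<^sub>1 s\<^sub>1 u\<^sub>1 r" "exec W c\<^sub>2 r u\<^sub>2 s''"
    by cases
  from Seq.IH(1)[OF r(1)] r(2) have "exec W c\<^sub>2 s\<^sub>2 u\<^sub>2 s''" by simp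
  from Seq.IH(1)[OF r(1)] Seq.IH(2)[OF this] u show ?case by simp
next
  case (Cond_True b s c\<^sub>1 t s' c\<^sub>2)
  from Cond_True.prems show ?case
    by cases (auto dest: Cond_True.IH simp: Cond_True.hyps)
next
  case (Cond_False b s c\<^sub>2 t s' c\<^sub>1)
  from Cond_False.prems show ?case
    by cases (auto dest: Cond_False.IH simp: Cond_False.hyps)
next
  case (While_False b s c)
  from While_False.prems show ?case
    by cases (use While_False.hyps in simp_all)
next
  case (While_True b s\<^sub>1 c t\<^sub>1 s\<^sub>2 t\<^sub>2 s\<^sub>3)
  from While_True.prems \<open>bval b s\<^sub>1\<close>
  obtain u\<^sub>1 r u\<^sub>2 where u: "u = 1 + bcost b + u\<^sub>1 + u\<^sub>2"
    and r: "exec W c s\<^sub>1 u\<^sub>1 r" "exec W (While b c) r u\<^sub>2 s''"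
    by cases simp_all
  from While_True.IH(1)[OF r(1)] r(2) have "exec W (While b c) s\<^sub>2 u\<^sub>2 s''" by simp
  from While_True.IH(1)[OF r(1)] While_True.IH(2)[OF this] u show ?case by simp
qed


section \<open>Dynamic algorithms\<close>

text \<open>The computation starts with the empty graph on \<open>{..<n}\<close> and with zeroed memory, except
  that variable \<open>n\<close> holds the number of vertices. The state left by one update is the
  state from which the next one starts, after the update has been stored in the variables
  \<open>op\<close> (0 for an insertion, 1 for a deletion), \<open>u\<close> and \<open>v\<close>.\<close>

definition initial_state :: "nat \<Rightarrow> state" where
  "initial_state n = \<lparr>var = (\<lambda>_. 0)(''n'' := n), arr = (\<lambda>_ _. 0)\<rparr>"

primrec feed :: "update \<Rightarrow> state \<Rightarrow> state" where
  "feed (Insert u v) s = set_var ''op'' 0 (set_var ''u'' u (set_var ''v'' v s))"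
| "feed (Delete u v) s = set_var ''op'' 1 (set_var ''u'' u (set_var ''v'' v s))"

text \<open>The matching is kept explicitly in the array \<open>mate\<close>: entry \<open>u\<close> is 0 if \<open>u\<close> is
  unmatched, and the successor of its partner otherwise. Since \<open>v\<close> is unrestricted, \<open>M\<close>
  determines the first \<open>n\<close> entries.\<close>

definition stores_matching :: "nat \<Rightarrow> state \<Rightarrow> nat set set \<Rightarrow> bool" where
  "stores_matching n s M \<longleftrightarrow> (\<forall>u<n. \<forall>v. arr s ''mate'' u = Suc v \<longleftrightarrow> {u, v} \<in> M)"

text \<open>\<open>maintains_maximum_matching W c n us T\<close>: processing the updates \<open>us\<close> one after the other
  with program \<open>c\<close> keeps a maximum matching of the current graph in memory at all times, and
  every update takes worst-case time at most \<open>T m\<close> where \<open>m\<close> is the size of the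
  matching stored after that update.\<close>

definition maintains_maximum_matching ::
  "nat \<Rightarrow> com \<Rightarrow> nat \<Rightarrow> update list \<Rightarrow> (nat \<Rightarrow> nat) \<Rightarrow> bool" where
  "maintains_maximum_matching W c n us T \<longleftrightarrow>
     (\<exists>(s :: nat \<Rightarrow> state) (t :: nat \<Rightarrow> nat) (M :: nat \<Rightarrow> nat set set).
        s 0 = initial_state n \<and>
        (\<forall>i\<le>length us. stores_matching n (s i) (M i) \<and>
           maximum_matching (graph_after (take i us)) (M i)) \<and>
        (\<forall>i<length us. exec W c (feed (us ! i) (s i)) (t i) (s (Suc i)) \<and>
           t i \<le> T (card (M (Suc i)))))"

end

theory Submission
  imports Defs
begin

text \<open>If an update makes a better matching possible and an end of the changed edge is free, then
  some augmenting path starts at such an end. If both ends of an inserted edge \<open>uv\<close> are matched, one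
  first looks for an even alternating path from the mate of \<open>u\<close> to a free vertex, which frees
  \<open>u\<close>; if there is none, every maximum matching covers \<open>u\<close> and the new edge is useless. A search
  visits only the root and matched vertices, and scanning an adjacency list stops at the first
  free neighbour, hence after at most \<open>2|M| + 1\<close> entries; so a search takes time \<open>O((|M| + 1)\<^sup>2)\<close>.
  A failed search leaves a set \<open>X\<close> containing the root whose neighbourhood \<open>A\<close> is matched into \<open>X\<close>.
  Exchanging edges at \<open>A \<union> X\<close> in an arbitrary matching then replaces the analysis of augmenting
  paths.\<close>

section \<open>Matchings and exchange\<close>

text \<open>The program knows neither a bipartition nor the optimum, so a failed search must itself
  prove that nothing better exists. The sets \<open>X\<close> and \<open>A\<close> form a
  certificate about edges only, and it is tested against an arbitrary competitor. This fixes the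
  place of the first search of an insertion: it runs in the old graph, where the matching is known
  to be maximum. A competitor using \<open>uv\<close> misses \<open>u\<close> once it gives up that
  edge, and the certificate at the mate of \<open>u\<close> then improves it, which pays for the new
  edge. After the loss of a matched edge both ends are searched; a failed search leaves the mates
  unchanged, so two failures certify the same matching. The cost is charged to the size after the
  update: the only step that shrinks the matching is unlinking, which takes constant time and
  precedes the searches. Bipartiteness enters through a colouring that exists only in the proof: all
  even vertices of a search lie on the side of its root, so no odd cycle interferes.\<close>

lemma matching_card_le_hitting:
  assumes "disjoint N" "finite A" "\<And>e. e \<in> N \<Longrightarrow> e \<inter> A \<noteq> {}"
  shows "card N \<le> card (A \<inter> \<Union>N)"
proof -
  define f where "f e = (SOME a. a \<in> e \<inter> A)" for e
  have f: "f e \<in> e \<inter> A" if "e \<in> N" for e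
    using assms(3)[OF that] unfolding f_def by (metis (mono_tags, lifting) equals0I someI_ex)
  have "inj_on f N"
  proof (rule inj_onI)
    fix e e' assume "e \<in> N" "e' \<in> N" "f e = f e'"
    with f[of e] f[of e'] show "e = e'"
      using disjointD[OF assms(1), of e e'] by auto
  qed
  moreover have "f ` N \<subseteq> A \<inter> \<Union>N" using f by blast
  ultimately show ?thesis using assms(2) by (meson card_inj_on_le finite_Int)
qed

text \<open>The edges of \<open>N\<close> that meet \<open>A \<union> X\<close> all meet \<open>A\<close>, so there are at most \<open>card (A \<inter> \<Union>N)\<close> of
  them; \<open>M\<close> offers \<open>card A\<close> edges in exchange.\<close>

lemma matching_exchange:
  assumes M: "matching E M" "finite M" and N: "matching E N" "finite N" and A: "finite A"
    and cover: "\<And>e. e \<in> E \<Longrightarrow> e \<inter> X \<noteq> {} \<Longrightarrow> e \<inter> A \<noteq> {}"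
    and sat: "\<And>a. a \<in> A \<Longrightarrow> \<exists>x\<in>X. {a, x} \<in> M"
    and disj: "X \<inter> A = {}"
  defines "N' \<equiv> {e \<in> N. e \<inter> (A \<union> X) = {}} \<union> {e \<in> M. e \<inter> A \<noteq> {}}"
  shows "matching E N'" "card N + card A \<le> card N' + card (A \<inter> \<Union>N)"
proof -
  let ?K = "{e \<in> N. e \<inter> (A \<union> X) = {}}" and ?MA = "{e \<in> M. e \<inter> A \<noteq> {}}"
    and ?NA = "{e \<in> N. e \<inter> A \<noteq> {}}"
  have dM: "disjoint M" and dN: "disjoint N" and subs: "M \<subseteq> E" "N \<subseteq> E"
    using M N by (auto simp: matching_def)
  \<comment> \<open>Since \<open>M\<close> is disjoint, an edge of \<open>M\<close> that meets
    \<open>A\<close> is one of the edges supplied by \<open>sat\<close>. It stays inside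
    \<open>A \<union> X\<close> and cannot touch a kept edge of \<open>N\<close>.\<close>
  have MA: "e \<subseteq> A \<union> X" if e: "e \<in> ?MA" for e
  proof -
    obtain a x where "a \<in> e" "a \<in> A" "x \<in> X" "{a, x} \<in> M" using e sat by fast
    moreover from this e have "e = {a, x}" using disjointD[OF dM, of e "{a, x}"] by auto
    ultimately show ?thesis by blast
  qed
  have "disjoint N'"
  proof (rule disjointI)
    fix e e' assume "e \<in> N'" "e' \<in> N'" "e \<noteq> e'"
    then consider "e \<in> N" "e' \<in> N" | "e \<in> M" "e' \<in> M" | "e \<in> ?K" "e' \<in> ?MA" | "e \<in> ?MA" "e' \<in> ?K"
      unfolding N'_def by blast
    then show "e \<inter> e' = {}"
    proof cases
      case 1 then show ?thesis using disjointD[OF dN] \<open>e \<noteq> e'\<close> by blast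
    next
      case 2 then show ?thesis using disjointD[OF dM] \<open>e \<noteq> e'\<close> by blast
    next
      case 3 then show ?thesis using MA[of e'] by blast
    next
      case 4 then show ?thesis using MA[of e] by blast
    qed
  qed
  then show "matching E N'" using subs by (auto simp: matching_def N'_def)
  obtain g where g: "\<And>a. a \<in> A \<Longrightarrow> g a \<in> X \<and> {a, g a} \<in> M" using sat by metis
  have "inj_on (\<lambda>a. {a, g a}) A"
    using g disj by (intro inj_onI) (auto simp: doubleton_eq_iff)
  then have cMA: "card A \<le> card ?MA"
    using g M(2) by (intro card_inj_on_le[where f = "\<lambda>a. {a, g a}"]) auto
  have "card N' = card ?K + card ?MA"
    unfolding N'_def using M(2) N(2) by (intro card_Un_disjoint) auto
  moreover have "card N \<le> card (?K \<union> ?NA)"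
    using cover subs N(2) by (intro card_mono) auto
  then have "card N \<le> card ?K + card ?NA" using card_Un_le[of ?K ?NA] by linarith
  moreover have "card ?NA \<le> card (A \<inter> \<Union>?NA)"
    using dN A by (intro matching_card_le_hitting) (auto intro: pairwise_mono)
  then have "card ?NA \<le> card (A \<inter> \<Union>N)"
    using A by (elim order_trans) (intro card_mono, auto)
  ultimately show "card N + card A \<le> card N' + card (A \<inter> \<Union>N)" using cMA by linarith
qed

lemma finite_matching: "matching E M \<Longrightarrow> finite E \<Longrightarrow> finite M"
  unfolding matching_def using finite_subset by blast

section \<open>Two-coloured edge sets and elementary facts on matchings\<close>

text \<open>One set describes both sides, so replacing \<open>S\<close> by \<open>- S\<close> swaps
  them. The search lemmas can therefore assume that the root lies in \<open>S\<close>.\<close>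

definition two_coloured :: "nat \<Rightarrow> nat set \<Rightarrow> nat set set \<Rightarrow> bool" where
  "two_coloured n S E \<longleftrightarrow> (\<forall>e\<in>E. \<exists>x y. e = {x, y} \<and> x < n \<and> y < n \<and> x \<in> S \<and> y \<notin> S)"

lemma bipartite_two_coloured:
  assumes "bipartite {..<n} E" shows "\<exists>S. two_coloured n S E"
proof -
  obtain L R where LR: "L \<union> R = {..<n}" "L \<inter> R = {}" "\<forall>e\<in>E. \<exists>x\<in>L. \<exists>y\<in>R. e = {x, y}"
    using assms unfolding bipartite_def by (elim exE conjE) (rule that)
  have "two_coloured n L E" unfolding two_coloured_def
  proof
    fix e assume "e \<in> E"
    then obtain x y where "x \<in> L" "y \<in> R" "e = {x, y}" using LR(3) by blast
    moreover have "x < n" "y < n" "y \<notin> L" using LR(1,2) \<open>x \<in> L\<close> \<open>y \<in> R\<close> by auto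
    ultimately show "\<exists>x y. e = {x, y} \<and> x < n \<and> y < n \<and> x \<in> L \<and> y \<notin> L" by blast
  qed
  then show ?thesis ..
qed

lemma two_coloured_uminus: "two_coloured n S E \<Longrightarrow> two_coloured n (- S) E"
  unfolding two_coloured_def by (fastforce simp: insert_commute)

lemma two_coloured_edge:
  assumes "two_coloured n S E" "{x, y} \<in> E"
  shows "x < n" "y < n" "x \<in> S \<longleftrightarrow> y \<notin> S" "x \<noteq> y"
  using assms unfolding two_coloured_def by (fastforce simp: doubleton_eq_iff)+

lemma two_coloured_doubleton:
  assumes "two_coloured n S E" "e \<in> E" obtains x y where "e = {x, y}"
  using assms unfolding two_coloured_def by blast

lemma two_coloured_finite: "two_coloured n S E \<Longrightarrow> finite E"
  by (rule finite_subset[of _ "Pow {..<n}"]) (auto simp: two_coloured_def)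

lemma two_coloured_mono: "two_coloured n S E \<Longrightarrow> E' \<subseteq> E \<Longrightarrow> two_coloured n S E'"
  unfolding two_coloured_def by blast

lemma maximum_matchingI:
  assumes "finite E" "matching E M" "\<And>N. matching E N \<Longrightarrow> card N \<le> card M"
  shows "maximum_matching E M"
  using assms unfolding maximum_matching_def by (blast intro: finite_matching)

lemma matching_subset: "matching E M \<Longrightarrow> M \<subseteq> E' \<Longrightarrow> matching E' M"
  by (auto simp: matching_def)

lemma matching_insert:
  "matching E M \<Longrightarrow> e \<in> E \<Longrightarrow> e \<inter> \<Union>M = {} \<Longrightarrow> matching E (insert e M)"
  unfolding matching_def by (auto simp: pairwise_insert disjnt_def)

lemma card_insert_matching:
  "finite M \<Longrightarrow> {x, y} \<inter> \<Union>M = {} \<Longrightarrow> card (insert {x, y} M) = Suc (card M)"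
  by (rule card_insert_disjoint) auto

section \<open>Matchings encoded as mate arrays\<close>

text \<open>A fixed point \<open>mt x = Suc x\<close> is possible if \<open>E\<close> contains the
  singleton of \<open>x\<close>; hence the assumptions such as \<open>x \<noteq> z\<close> below. A
  two-coloured \<open>E\<close> excludes it.\<close>

definition mate_ok :: "nat set set \<Rightarrow> (nat \<Rightarrow> nat) \<Rightarrow> bool" where
  "mate_ok E mt \<longleftrightarrow> (\<forall>x y. mt x = Suc y \<longrightarrow> {x, y} \<in> E \<and> mt y = Suc x)"

definition pairs :: "(nat \<Rightarrow> nat) \<Rightarrow> nat set set" where
  "pairs mt = {{x, y} | x y. mt x = Suc y}"

lemma mate_okD: "mate_ok E mt \<Longrightarrow> mt x = Suc y \<Longrightarrow> {x, y} \<in> E \<and> mt y = Suc x"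
  unfolding mate_ok_def by blast

lemma mate_ok_mono: "mate_ok E mt \<Longrightarrow> E \<subseteq> E' \<Longrightarrow> mate_ok E' mt"
  unfolding mate_ok_def by blast

lemma mate_ok_sym: "mate_ok E mt \<Longrightarrow> mt x = Suc y \<longleftrightarrow> mt y = Suc x"
  using mate_okD by blast

lemma in_pairs_iff:
  assumes "mate_ok E mt" shows "{x, y} \<in> pairs mt \<longleftrightarrow> mt x = Suc y"
proof
  assume "{x, y} \<in> pairs mt"
  then obtain a b where "{x, y} = {a, b}" "mt a = Suc b" unfolding pairs_def by blast
  then show "mt x = Suc y" using mate_ok_sym[OF assms, of a b] by (auto simp: doubleton_eq_iff)
qed (auto simp: pairs_def)

lemma Union_pairs:
  assumes "mate_ok E mt" shows "\<Union>(pairs mt) = {x. mt x \<noteq> 0}"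
proof (rule set_eqI)
  fix x
  show "x \<in> \<Union>(pairs mt) \<longleftrightarrow> x \<in> {x. mt x \<noteq> 0}"
  proof
    assume "x \<in> \<Union>(pairs mt)"
    then obtain a b where "x \<in> {a, b}" "mt a = Suc b" unfolding pairs_def by blast
    then show "x \<in> {x. mt x \<noteq> 0}" using mate_ok_sym[OF assms, of a b] by auto
  next
    assume "x \<in> {x. mt x \<noteq> 0}"
    then obtain y where "mt x = Suc y" by (auto simp: gr0_conv_Suc)
    then show "x \<in> \<Union>(pairs mt)" unfolding pairs_def by blast
  qed
qed

lemma matching_pairs:
  assumes "mate_ok E mt" shows "matching E (pairs mt)"
proof -
  have "e = e'" if "e \<in> pairs mt" "e' \<in> pairs mt" "z \<in> e" "z \<in> e'" for e e' z
  proof -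
    have "\<exists>w. f = {z, w} \<and> mt z = Suc w" if f: "f \<in> pairs mt" "z \<in> f" for f
    proof -
      obtain x y where "f = {x, y}" "mt x = Suc y" using f(1) by (auto simp: pairs_def)
      moreover from this have "mt y = Suc x" using assms mate_okD by blast
      ultimately show ?thesis using f(2) by auto
    qed
    from this[of e] this[of e'] that show ?thesis by auto
  qed
  then have "disjoint (pairs mt)" by (intro disjointI) blast
  moreover have "pairs mt \<subseteq> E" unfolding pairs_def using mate_okD[OF assms] by blast
  ultimately show ?thesis by (simp add: matching_def)
qed

lemma finite_pairs: "finite E \<Longrightarrow> mate_ok E mt \<Longrightarrow> finite (pairs mt)"
  using matching_pairs finite_matching by blast

text \<open>The queue without its root and the scanned prefix of an adjacency list both consist of
  matched vertices; this bound turns their lengths into multiples of the matching size.\<close>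

lemma card_matched:
  assumes "finite E" "mate_ok E mt"
  shows "finite {x. mt x \<noteq> 0}" "card {x. mt x \<noteq> 0} \<le> 2 * card (pairs mt)"
proof -
  have c: "finite e \<and> card e \<le> 2" if "e \<in> pairs mt" for e
    using that by (auto simp: pairs_def card_insert_if)
  have fin: "finite (pairs mt)" using assms by (rule finite_pairs)
  then show "finite {x. mt x \<noteq> 0}" using c Union_pairs[OF assms(2)] by (metis finite_Union)
  have "card (\<Union>(pairs mt)) \<le> sum card (pairs mt)" by (rule card_Union_le_sum_card)
  also have "\<dots> \<le> card (pairs mt) * 2" using c sum_bounded_above[of "pairs mt" card 2] by auto
  finally show "card {x. mt x \<noteq> 0} \<le> 2 * card (pairs mt)"
    using Union_pairs[OF assms(2)] by simp
qed

text \<open>Shrinking \<open>E\<close> together with the matching suits the deletion of a matched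
  edge; for rematching, \<open>mate_ok_mono\<close> leads back to \<open>E\<close>.\<close>

lemma mate_unlink:
  assumes "mate_ok E mt" "mt x = Suc z" "x \<noteq> z"
  shows "mate_ok (E - {{x, z}}) (mt(x := 0, z := 0))"
    and "pairs (mt(x := 0, z := 0)) = pairs mt - {{x, z}}"
proof -
  have z: "mt z = Suc x" using assms mate_okD by blast
  have *: "a \<noteq> x \<and> a \<noteq> z \<and> b \<noteq> x \<and> b \<noteq> z" if "(mt(x := 0, z := 0)) a = Suc b" for a b
    using that assms z mate_okD[OF assms(1), of a b] by (auto split: if_splits)
  show "mate_ok (E - {{x, z}}) (mt(x := 0, z := 0))"
    unfolding mate_ok_def
  proof (intro allI impI)
    fix a b assume ab: "(mt(x := 0, z := 0)) a = Suc b"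
    then have "mt a = Suc b" using *[OF ab] by simp
    from mate_okD[OF assms(1) this] show "{a, b} \<in> E - {{x, z}} \<and> (mt(x := 0, z := 0)) b = Suc a"
      using *[OF ab] by (auto simp: doubleton_eq_iff)
  qed
  show "pairs (mt(x := 0, z := 0)) = pairs mt - {{x, z}}"
  proof (rule set_eqI)
    fix e
    show "e \<in> pairs (mt(x := 0, z := 0)) \<longleftrightarrow> e \<in> pairs mt - {{x, z}}"
    proof
      assume "e \<in> pairs (mt(x := 0, z := 0))"
      then obtain a b where e: "e = {a, b}" and ab: "(mt(x := 0, z := 0)) a = Suc b"
        unfolding pairs_def by blast
      from *[OF ab] ab have "mt a = Suc b" by simp
      then have "e \<in> pairs mt" unfolding pairs_def e by blast
      then show "e \<in> pairs mt - {{x, z}}" using *[OF ab] e by (auto simp: doubleton_eq_iff)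
    next
      assume "e \<in> pairs mt - {{x, z}}"
      then obtain a b where e: "e = {a, b}" "mt a = Suc b" "e \<noteq> {x, z}" unfolding pairs_def by blast
      then have "a \<noteq> x" "a \<noteq> z" using assms z by auto
      then have "(mt(x := 0, z := 0)) a = Suc b" using e by simp
      then show "e \<in> pairs (mt(x := 0, z := 0))" unfolding pairs_def e(1) by blast
    qed
  qed
qed

lemma mate_link:
  assumes "mate_ok E mt" "mt x = 0" "mt y = 0" "x \<noteq> y" "{x, y} \<in> E"
  shows "mate_ok E (mt(x := Suc y, y := Suc x))"
    and "pairs (mt(x := Suc y, y := Suc x)) = insert {x, y} (pairs mt)"
    and "{x, y} \<notin> pairs mt"
proof -
  have *: "b \<noteq> x \<and> b \<noteq> y" if "mt a = Suc b" for a b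
    using that assms mate_okD[OF assms(1), of a b] by auto
  show "mate_ok E (mt(x := Suc y, y := Suc x))"
    unfolding mate_ok_def
  proof (intro allI impI)
    fix a b assume ab: "(mt(x := Suc y, y := Suc x)) a = Suc b"
    consider "a = x" | "a = y" "x \<noteq> a" | "a \<noteq> x" "a \<noteq> y" "mt a = Suc b" using ab by (auto split: if_splits)
    then show "{a, b} \<in> E \<and> (mt(x := Suc y, y := Suc x)) b = Suc a"
    proof cases
      case 3
      then show ?thesis using *[OF 3(3)] mate_okD[OF assms(1) 3(3)] by simp
    qed (use ab assms(4,5) in \<open>auto simp: insert_commute\<close>)
  qed
  show "{x, y} \<notin> pairs mt" using in_pairs_iff[OF assms(1)] assms by simp
  show "pairs (mt(x := Suc y, y := Suc x)) = insert {x, y} (pairs mt)"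
  proof (rule set_eqI)
    fix e
    show "e \<in> pairs (mt(x := Suc y, y := Suc x)) \<longleftrightarrow> e \<in> insert {x, y} (pairs mt)"
    proof
      assume "e \<in> pairs (mt(x := Suc y, y := Suc x))"
      then obtain a b where "e = {a, b}" "(mt(x := Suc y, y := Suc x)) a = Suc b"
        unfolding pairs_def by blast
      then show "e \<in> insert {x, y} (pairs mt)"
        unfolding pairs_def by (cases "a = x \<or> a = y") (auto split: if_splits)
    next
      assume "e \<in> insert {x, y} (pairs mt)"
      then consider "e = {x, y}" | a b where "e = {a, b}" "mt a = Suc b" by (auto simp: pairs_def)
      then show "e \<in> pairs (mt(x := Suc y, y := Suc x))"
      proof cases
        case 1
        moreover have "(mt(x := Suc y, y := Suc x)) x = Suc y" using assms(4) by simp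
        ultimately show ?thesis unfolding pairs_def by blast
      next
        case 2
        then have "a \<noteq> x" "a \<noteq> y" using assms by auto
        then have "(mt(x := Suc y, y := Suc x)) a = Suc b" using 2 by simp
        then show ?thesis unfolding pairs_def 2(1) by blast
      qed
    qed
  qed
qed

text \<open>One step of flipping an alternating path, seen from its free end \<open>y\<close>: the
  mate that \<open>x\<close> gives up is the free end for the next step.\<close>

definition rematch :: "nat \<Rightarrow> nat \<Rightarrow> (nat \<Rightarrow> nat) \<Rightarrow> nat \<Rightarrow> nat" where
  "rematch x y mt = (if mt x = 0 then mt else mt(mt x - 1 := 0))(x := Suc y, y := Suc x)"

text \<open>Keeps every intermediate state of a flip a matching. The size grows only at an unmatched
  \<open>x\<close>, and on a search path only the root can be unmatched among the even
  vertices.\<close>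

lemma rematch:
  assumes "finite E" "mate_ok E mt" "mt y = 0" "x \<noteq> y" "{x, y} \<in> E" "mt x \<noteq> Suc x"
  shows "mate_ok E (rematch x y mt)"
    and "card (pairs (rematch x y mt)) = card (pairs mt) + (if mt x = 0 then 1 else 0)"
proof -
  have fin: "finite (pairs mt)" using assms(1,2) by (rule finite_pairs)
  have "mate_ok E (rematch x y mt) \<and>
    card (pairs (rematch x y mt)) = card (pairs mt) + (if mt x = 0 then 1 else 0)"
  proof (cases "mt x")
    case 0
    then show ?thesis using mate_link[OF assms(2) 0 assms(3-5)] fin by (simp add: rematch_def)
  next
    case (Suc z)
    let ?m = "mt(x := 0, z := 0)"
    have xz: "x \<noteq> z" using assms(6) Suc by auto
    have zx: "mt z = Suc x" using Suc assms(2) mate_okD by blast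
    then have yz: "y \<noteq> z" using assms(3) by auto
    note un = mate_unlink[OF assms(2) Suc xz]
    have ok: "mate_ok E ?m" using un(1) by (rule mate_ok_mono) auto
    \<comment> \<open>\<open>rematch\<close> clears only the entry of \<open>z\<close>. The entry of
      \<open>x\<close> is overwritten by the new link, so clearing it as well makes no difference
      and reduces the step to an unlink followed by a link.\<close>
    have eq: "rematch x y mt = ?m(x := Suc y, y := Suc x)"
      using Suc by (auto simp: rematch_def fun_eq_iff)
    have "?m x = 0" "?m y = 0" using assms(3) by simp_all
    note ln = mate_link[OF ok this assms(4,5)]
    have "{x, z} \<in> pairs mt" using Suc by (auto simp: pairs_def)
    then have "card (pairs mt) = Suc (card (pairs mt - {{x, z}}))"
      using fin by (rule card.remove[rotated])
    moreover have "pairs (rematch x y mt) = insert {x, y} (pairs mt - {{x, z}})"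
      unfolding eq ln(2) un(2) ..
    moreover have "{x, y} \<notin> pairs mt - {{x, z}}" using ln(3) unfolding un(2) .
    moreover have "mate_ok E (rematch x y mt)" unfolding eq by (rule ln(1))
    ultimately show ?thesis using fin Suc by simp
  qed
  then show "mate_ok E (rematch x y mt)"
    "card (pairs (rematch x y mt)) = card (pairs mt) + (if mt x = 0 then 1 else 0)" by auto
qed

section \<open>Certificates of failed searches, and maximality after an update\<close>

text \<open>\<open>X\<close> and \<open>A\<close> are the even and odd vertices of a Hungarian tree
  rooted at \<open>r\<close>. If \<open>r\<close> is free and \<open>X\<close> finite,
  \<open>X\<close> violates Hall's condition: its neighbours lie in \<open>A\<close>, and
  \<open>A\<close> is matched into \<open>X\<close> without \<open>r\<close>.\<close>

definition blocked :: "nat set set \<Rightarrow> (nat \<Rightarrow> nat) \<Rightarrow> nat \<Rightarrow> bool" where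
  "blocked E mt r \<longleftrightarrow> (\<exists>X A. r \<in> X \<and> X \<inter> A = {} \<and> finite A \<and>
     (\<forall>x\<in>X. \<forall>y. {x, y} \<in> E \<longrightarrow> y \<in> A) \<and> (\<forall>y\<in>A. \<exists>x\<in>X. mt y = Suc x))"

text \<open>If \<open>r\<close> is matched to \<open>u\<close>, then \<open>u\<close> lies in
  \<open>A\<close>, so a matching that misses \<open>u\<close> loses fewer than
  \<open>card A\<close> edges in the exchange and gains strictly. The inclusion in
  \<open>N \<union> pairs mt\<close> lets a second exchange preserve what a first one
  achieved.\<close>

lemma blocked_exchange:
  assumes "two_coloured n S E" "mate_ok E mt" "blocked E mt r" "matching E N"
  obtains N' where "matching E N'" "card N \<le> card N'" "mt r = 0 \<Longrightarrow> r \<notin> \<Union>N'"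
    "N' \<subseteq> N \<union> pairs mt" "\<And>u. mt r = Suc u \<Longrightarrow> u \<notin> \<Union>N \<Longrightarrow> card N < card N'"
proof -
  obtain X A where XA: "r \<in> X" "X \<inter> A = {}" "finite A" "\<And>x y. x \<in> X \<Longrightarrow> {x, y} \<in> E \<Longrightarrow> y \<in> A"
    "\<And>y. y \<in> A \<Longrightarrow> \<exists>x\<in>X. mt y = Suc x" using assms(3) unfolding blocked_def by meson
  let ?M = "pairs mt"
  let ?N' = "{e \<in> N. e \<inter> (A \<union> X) = {}} \<union> {e \<in> ?M. e \<inter> A \<noteq> {}}"
  have finE: "finite E" using assms(1) by (rule two_coloured_finite)
  have finN: "finite N" using assms(4) finE by (rule finite_matching)
  have cover: "e \<inter> A \<noteq> {}" if e: "e \<in> E" "e \<inter> X \<noteq> {}" for e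
  proof -
    obtain x y where "e = {x, y}" using assms(1) e(1) by (rule two_coloured_doubleton)
    moreover from this e(1) have "{x, y} \<in> E" "{y, x} \<in> E" by (auto simp: insert_commute)
    ultimately show ?thesis using e(2) XA(4)[of x y] XA(4)[of y x] by auto
  qed
  have sat: "\<exists>x\<in>X. {a, x} \<in> ?M" if "a \<in> A" for a
    using XA(5)[OF that] by (auto simp: pairs_def)
  note ex = matching_exchange[OF matching_pairs[OF assms(2)] finite_pairs[OF finE assms(2)] assms(4)
      finN XA(3) cover sat XA(2)]
  have le: "card (A \<inter> \<Union>N) \<le> card A" using XA(3) by (intro card_mono) auto
  show thesis
  proof (rule that[of ?N'])
    show "matching E ?N'" by (rule ex(1))
    show "card N \<le> card ?N'" using ex(2) le by linarith
    show "?N' \<subseteq> N \<union> ?M" by blast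
    show "r \<notin> \<Union>?N'" if "mt r = 0" using Union_pairs[OF assms(2)] that XA(1) by blast
    show "card N < card ?N'" if u: "mt r = Suc u" "u \<notin> \<Union>N" for u
    proof -
      have "u \<in> A" using u(1) XA(1,4) mate_okD[OF assms(2)] by blast
      then have "card (A \<inter> \<Union>N) < card A" using u(2) XA(3) by (intro psubset_card_mono) auto
      then show ?thesis using ex(2) by linarith
    qed
  qed
qed

lemma maximum_matching_card:
  "maximum_matching E M \<Longrightarrow> matching E N \<Longrightarrow> card N \<le> card M"
  by (simp add: maximum_matching_def)

lemma matching_remove_edge: "matching (insert e E) N \<Longrightarrow> matching E (N - {e})"
  unfolding matching_def by (auto intro: pairwise_subset)

text \<open>A competitor that uses the new edge misses \<open>u\<close> once this edge is removed.
  The exchange at the mate of \<open>u\<close> then gains an edge, which makes up for the removed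
  one within the old graph.\<close>

lemma maximum_insert_blocked_mate:
  assumes two: "two_coloured n S (insert {u, v} E)" and ok: "mate_ok E mt"
    and max: "maximum_matching E (pairs mt)"
    and u: "mt u = Suc p" and bl: "blocked E mt p"
  shows "maximum_matching (insert {u, v} E) (pairs mt)"
proof (rule maximum_matchingI)
  show "finite (insert {u, v} E)" using two by (rule two_coloured_finite)
  show "matching (insert {u, v} E) (pairs mt)"
    using matching_pairs[OF ok] by (rule matching_subset) (use matching_pairs[OF ok] in \<open>auto simp: matching_def\<close>)
  fix N assume N: "matching (insert {u, v} E) N"
  have finN: "finite N" using N two_coloured_finite[OF two] by (rule finite_matching)
  have mp: "mt p = Suc u" using u ok mate_okD by blast
  have N1: "matching E (N - {{u, v}})" using N by (rule matching_remove_edge)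
  show "card N \<le> card (pairs mt)"
  proof (cases "{u, v} \<in> N")
    case False then show ?thesis using N1 maximum_matching_card[OF max] by force
  next
    case True
    have unc: "u \<notin> \<Union>(N - {{u, v}})"
      using disjointD[of N _ "{u, v}"] N True unfolding matching_def by blast
    have twoE: "two_coloured n S E" using two by (rule two_coloured_mono) auto
    obtain N' where "matching E N'" "card (N - {{u, v}}) < card N'"
      using blocked_exchange[OF twoE ok bl N1] unc mp by metis
    then show ?thesis using maximum_matching_card[OF max, of N'] card.remove[OF finN True] by simp
  qed
qed

text \<open>The exchange makes a competitor miss \<open>u\<close>, hence the new edge, and so turns
  it into a matching of the old graph.\<close>

lemma maximum_insert_blocked_free:
  assumes two: "two_coloured n S (insert {u, v} E)" and ok: "mate_ok E mt"
    and max: "maximum_matching E (pairs mt)"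
    and u: "mt u = 0" and bl: "blocked (insert {u, v} E) mt u"
  shows "maximum_matching (insert {u, v} E) (pairs mt)"
proof (rule maximum_matchingI)
  show "finite (insert {u, v} E)" using two by (rule two_coloured_finite)
  have ok': "mate_ok (insert {u, v} E) mt" using ok by (rule mate_ok_mono) auto
  then show "matching (insert {u, v} E) (pairs mt)" by (rule matching_pairs)
  fix N assume "matching (insert {u, v} E) N"
  then obtain N' where N': "matching (insert {u, v} E) N'" "card N \<le> card N'" "u \<notin> \<Union>N'"
    using blocked_exchange[OF two ok' bl] u by metis
  then have "matching E N'" by (auto simp: matching_def)
  then show "card N \<le> card (pairs mt)" using maximum_matching_card[OF max] N'(2) by fastforce
qed

text \<open>A single new edge raises the maximum by at most one.\<close>

lemma maximum_insert_larger:
  assumes "finite E" "maximum_matching E M" "matching (insert e E) M'" "card M' = Suc (card M)"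
  shows "maximum_matching (insert e E) M'"
proof (rule maximum_matchingI)
  fix N assume N: "matching (insert e E) N"
  have "card N \<le> Suc (card (N - {e}))" by (simp add: card_Diff_singleton_if) linarith
  then show "card N \<le> card M'"
    using assms maximum_matching_card[OF assms(2) matching_remove_edge[OF N]] by simp
qed (use assms in auto)

lemma maximum_delete:
  assumes "maximum_matching E M" "matching (E - D) M'" "card M \<le> card M'" "finite E"
  shows "maximum_matching (E - D) M'"
proof (rule maximum_matchingI)
  fix N assume "matching (E - D) N"
  then have "matching E N" by (auto simp: matching_def)
  then show "card N \<le> card M'" using maximum_matching_card[OF assms(1)] assms(3) by fastforce
qed (use assms in auto)

text \<open>Two exchanges make a competitor miss both \<open>u\<close> and \<open>v\<close>. Adding
  the deleted edge back gives a matching of the old graph, so the competitor is smaller than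
  \<open>M\<close> by at least one edge.\<close>

lemma maximum_delete_blocked:
  assumes two: "two_coloured n S E" and ok: "mate_ok (E - {{u, v}}) mt" and uv: "{u, v} \<in> E"
    and max: "maximum_matching E M" "card M = Suc (card (pairs mt))"
    and free: "mt u = 0" "mt v = 0"
    and bl: "blocked (E - {{u, v}}) mt u" "blocked (E - {{u, v}}) mt v"
  shows "maximum_matching (E - {{u, v}}) (pairs mt)"
proof (rule maximum_matchingI)
  let ?E = "E - {{u, v}}"
  have two': "two_coloured n S ?E" using two by (rule two_coloured_mono) auto
  show "finite ?E" using two' by (rule two_coloured_finite)
  show "matching ?E (pairs mt)" using ok by (rule matching_pairs)
  fix N assume "matching ?E N"
  then obtain N1 where N1: "matching ?E N1" "card N \<le> card N1" "u \<notin> \<Union>N1"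
    using blocked_exchange[OF two' ok bl(1)] free by metis
  obtain N2 where N2: "matching ?E N2" "card N1 \<le> card N2" "v \<notin> \<Union>N2" "N2 \<subseteq> N1 \<union> pairs mt"
    using blocked_exchange[OF two' ok bl(2) N1(1)] free by metis
  \<comment> \<open>The second exchange draws only on \<open>N1\<close> and the current matching,
    and both miss \<open>u\<close>.\<close>
  have "u \<notin> \<Union>N2" using N1(3) N2(4) Union_pairs[OF ok] free by blast
  then have disj: "{u, v} \<inter> \<Union>N2 = {}" using N2(3) by blast
  have "matching E (insert {u, v} N2)"
    using N2(1) uv disj by (intro matching_insert) (auto simp: matching_def)
  then have "card (insert {u, v} N2) \<le> card M" using max(1) maximum_matching_card by blast
  moreover have "finite N2" using N2(1) \<open>finite ?E\<close> by (rule finite_matching)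
  ultimately show "card N \<le> card (pairs mt)"
    using card_insert_matching[OF _ disj] N1 N2 max(2) by simp
qed

section \<open>Running programs\<close>

text \<open>A weakest precondition for total correctness with the running time passed to the
  postcondition. Existence of an execution suffices by \<open>exec_deterministic\<close>. The
  equations below turn loop-free code into rewriting.\<close>

definition run :: "nat \<Rightarrow> com \<Rightarrow> state \<Rightarrow> (nat \<Rightarrow> state \<Rightarrow> bool) \<Rightarrow> bool" where
  "run W c s Q \<longleftrightarrow> (\<exists>t s'. exec W c s t s' \<and> Q t s')"

lemma exec_iffs:
  "exec W Skip s t s' \<longleftrightarrow> t = 1 \<and> s' = s"
  "exec W (Assign x a) s t s' \<longleftrightarrow> afits W a s \<and> t = 1 + acost a \<and> s' = set_var x (aval a s) s"
  "exec W (Write x i a) s t s' \<longleftrightarrow> afits W i s \<and> afits W a s \<and>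
     t = 1 + acost i + acost a \<and> s' = set_arr x (aval i s) (aval a s) s"
  "exec W (Seq c\<^sub>1 c\<^sub>2) s t s' \<longleftrightarrow>
     (\<exists>t\<^sub>1 s\<^sub>1 t\<^sub>2. exec W c\<^sub>1 s t\<^sub>1 s\<^sub>1 \<and> exec W c\<^sub>2 s\<^sub>1 t\<^sub>2 s' \<and> t = 1 + t\<^sub>1 + t\<^sub>2)"
  "exec W (Cond b c\<^sub>1 c\<^sub>2) s t s' \<longleftrightarrow>
     bfits W b s \<and> (\<exists>t\<^sub>1. exec W (if bval b s then c\<^sub>1 else c\<^sub>2) s t\<^sub>1 s' \<and> t = 1 + bcost b + t\<^sub>1)"
  by (subst exec.simps, force)+

lemma run_Skip: "run W Skip s Q \<longleftrightarrow> Q 1 s"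
  unfolding run_def exec_iffs by blast

lemma run_Assign:
  "run W (Assign x a) s Q \<longleftrightarrow> afits W a s \<and> Q (1 + acost a) (set_var x (aval a s) s)"
  unfolding run_def exec_iffs by blast

lemma run_Write:
  "run W (Write x i a) s Q \<longleftrightarrow>
     afits W i s \<and> afits W a s \<and> Q (1 + acost i + acost a) (set_arr x (aval i s) (aval a s) s)"
  unfolding run_def exec_iffs by blast

lemma run_Seq:
  "run W (Seq c\<^sub>1 c\<^sub>2) s Q \<longleftrightarrow>
     run W c\<^sub>1 s (\<lambda>t\<^sub>1 s\<^sub>1. run W c\<^sub>2 s\<^sub>1 (\<lambda>t\<^sub>2 s\<^sub>2. Q (1 + t\<^sub>1 + t\<^sub>2) s\<^sub>2))"
  unfolding run_def exec_iffs by blast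

lemma run_Cond:
  "run W (Cond b c\<^sub>1 c\<^sub>2) s Q \<longleftrightarrow>
     bfits W b s \<and> run W (if bval b s then c\<^sub>1 else c\<^sub>2) s (\<lambda>t. Q (1 + bcost b + t))"
  unfolding run_def exec_iffs by blast

lemma run_mono: "run W c s P \<Longrightarrow> (\<And>t s'. P t s' \<Longrightarrow> Q t s') \<Longrightarrow> run W c s Q"
  unfolding run_def by blast

text \<open>The potential pays for guard and body of every round. As each round costs at least one
  unit, the potential decreases strictly, so it also proves termination.\<close>

lemma run_While:
  assumes "I s" and fits: "\<And>s. I s \<Longrightarrow> bfits W b s"
    and step: "\<And>s. I s \<Longrightarrow> bval b s \<Longrightarrow>
      run W c s (\<lambda>t s'. I s' \<and> 1 + bcost b + t + \<Phi> s' \<le> (\<Phi> s :: nat))"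
  shows "run W (While b c) s (\<lambda>t s'. I s' \<and> \<not> bval b s' \<and> t + \<Phi> s' \<le> \<Phi> s + 1 + bcost b)"
  using \<open>I s\<close>
proof (induction "\<Phi> s" arbitrary: s rule: less_induct)
  case less
  show ?case
  proof (cases "bval b s")
    case False
    then have "exec W (While b c) s (1 + bcost b) s"
      using fits less.prems by (blast intro: exec.While_False)
    then show ?thesis using False less.prems unfolding run_def by (intro exI conjI) auto
  next
    case True
    obtain t1 s1 where 1: "exec W c s t1 s1" "I s1" "1 + bcost b + t1 + \<Phi> s1 \<le> \<Phi> s"
      using step[OF less.prems True] unfolding run_def by blast
    then have "\<Phi> s1 < \<Phi> s" by linarith
    from less.hyps[OF this 1(2)] obtain t2 s2 where 2: "exec W (While b c) s1 t2 s2" "I s2"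
      "\<not> bval b s2" "t2 + \<Phi> s2 \<le> \<Phi> s1 + 1 + bcost b"
      unfolding run_def by blast
    have "exec W (While b c) s (1 + bcost b + t1 + t2) s2"
      using exec.While_True[OF fits[OF less.prems] True 1(1) 2(1)] .
    moreover have "1 + bcost b + t1 + t2 + \<Phi> s2 \<le> \<Phi> s + 1 + bcost b" using 1(3) 2(4) by linarith
    ultimately show ?thesis using 2(2,3) unfolding run_def by blast
  qed
qed

lemma run_While_False: "bfits W b s \<Longrightarrow> \<not> bval b s \<Longrightarrow> Q (1 + bcost b) s \<Longrightarrow> run W (While b c) s Q"
  unfolding run_def by (blast intro: exec.While_False)

lemmas run_simps = run_Skip run_Assign run_Write run_Seq run_Cond

section \<open>Memory updates and the word bound\<close>

lemma var_set_var [simp]: "var (set_var x k s) y = (if y = x then k else var s y)"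
  by (simp add: set_var_def)

lemma arr_set_var [simp]: "arr (set_var x k s) = arr s"
  by (simp add: set_var_def)

lemma var_set_arr [simp]: "var (set_arr a i k s) = var s"
  by (simp add: set_arr_def)

lemma arr_set_arr [simp]: "arr (set_arr a i k s) b = (if b = a then (arr s a)(i := k) else arr s b)"
  by (simp add: set_arr_def)

text \<open>Array indices of the form \<open>x * n + i\<close> are the largest numbers that occur.\<close>

definition word :: "nat \<Rightarrow> nat" where
  "word n = (n + 2)\<^sup>2"

lemma word_eq: "word n = n * n + 4 * n + 4"
  by (simp add: word_def power2_eq_square)

lemma word_less: "k \<le> n + 1 \<Longrightarrow> k < word n"
  unfolding word_eq by linarith

lemma word_index: "a \<le> n \<Longrightarrow> b \<le> n \<Longrightarrow> a * n + b < word n" "a \<le> n \<Longrightarrow> a * n < word n"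
  using mult_le_mono1[of a n n] unfolding word_eq by linarith+

text \<open>What is stored never exceeds \<open>n\<close>; only successors and index expressions do,
  and \<open>word_less\<close> and \<open>word_index\<close> show that these still fit into a
  word.\<close>

definition bounded :: "nat \<Rightarrow> state \<Rightarrow> bool" where
  "bounded n s \<longleftrightarrow> (\<forall>x. var s x \<le> n) \<and> (\<forall>a i. arr s a i \<le> n)"

lemma boundedD: "bounded n s \<Longrightarrow> var s x \<le> n" "bounded n s \<Longrightarrow> arr s a i \<le> n"
  by (auto simp: bounded_def)

lemma bounded_fits:
  assumes "bounded n s"
  shows "var s x < word n" "arr s a i < word n" "Suc (var s x) < word n" "Suc (arr s a i) < word n"
  by (auto intro!: word_less boundedD[OF assms] le_SucI)

lemma bounded_set_var [simp]: "bounded n s \<Longrightarrow> k \<le> n \<Longrightarrow> bounded n (set_var x k s)"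
  by (auto simp: bounded_def)

lemma bounded_set_arr [simp]: "bounded n s \<Longrightarrow> k \<le> n \<Longrightarrow> bounded n (set_arr a i k s)"
  by (auto simp: bounded_def)

lemma word_const: "0 < word n" "1 < word n" "Suc 0 < word n" "n < word n" "Suc n < word n"
  by (auto intro: word_less)

lemmas fits_simps = word_const bounded_fits word_index boundedD

section \<open>Adjacency arrays\<close>

lemma index_eq_iff:
  fixes n :: nat
  assumes "i < n" "i' < n"
  shows "x * n + i = x' * n + i' \<longleftrightarrow> x = x' \<and> i = i'"
proof
  assume eq: "x * n + i = x' * n + i'"
  have "x = (x * n + i) div n" "i = (x * n + i) mod n" using assms by auto
  moreover have "x' = (x' * n + i') div n" "i' = (x' * n + i') mod n" using assms by auto
  ultimately show "x = x' \<and> i = i'" using eq by metis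
qed simp

text \<open>Within each row \<open>ix\<close> inverts \<open>ad\<close>, so that an arc can be
  removed without scanning its list. \<open>D\<close> consists of ordered pairs because an edge is
  updated as two arcs in turn, and in between the relation is not symmetric.\<close>

definition adj_ok :: "nat \<Rightarrow> (nat \<times> nat) set \<Rightarrow> (nat \<Rightarrow> nat) \<Rightarrow> (nat \<Rightarrow> nat) \<Rightarrow> (nat \<Rightarrow> nat) \<Rightarrow> bool" where
  "adj_ok n D dg ad ix \<longleftrightarrow>
     (\<forall>x<n. \<forall>i<dg x. (x, ad (x * n + i)) \<in> D \<and> ix (x * n + ad (x * n + i)) = i) \<and>
     (\<forall>(x, y)\<in>D. x < n \<and> y < n \<and> ix (x * n + y) < dg x \<and> ad (x * n + ix (x * n + y)) = y)"

lemma adj_okD1: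
  assumes "adj_ok n D dg ad ix" "x < n" "i < dg x"
  shows "(x, ad (x * n + i)) \<in> D" "ix (x * n + ad (x * n + i)) = i"
  using assms unfolding adj_ok_def by blast+

lemma adj_okD2:
  assumes "adj_ok n D dg ad ix" "(x, y) \<in> D"
  shows "x < n" "y < n" "ix (x * n + y) < dg x" "ad (x * n + ix (x * n + y)) = y"
  using assms unfolding adj_ok_def by blast+

lemma adj_ok_inj: "adj_ok n D dg ad ix \<Longrightarrow> x < n \<Longrightarrow> inj_on (\<lambda>i. ad (x * n + i)) {..<dg x}"
  by (rule inj_on_inverseI[where g = "\<lambda>w. ix (x * n + w)"]) (simp add: adj_okD1(2))

lemma adj_ok_deg_le:
  assumes "adj_ok n D dg ad ix" "x < n"
  shows "dg x \<le> n"
proof -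
  have "(\<lambda>i. ad (x * n + i)) ` {..<dg x} \<subseteq> {..<n}"
    using adj_okD2(2)[OF assms(1) adj_okD1(1)[OF assms]] by auto
  from card_inj_on_le[OF adj_ok_inj[OF assms] this] show ?thesis by simp
qed

text \<open>Room for one more entry: the present neighbours of \<open>x\<close> are distinct and
  differ from \<open>y\<close>, so the cell \<open>x * n + dg x\<close> does not spill into the next
  row.\<close>

lemma adj_ok_deg_less:
  assumes "adj_ok n D dg ad ix" "x < n" "y < n" "(x, y) \<notin> D"
  shows "dg x < n"
proof -
  have "(\<lambda>i. ad (x * n + i)) ` {..<dg x} \<subseteq> {..<n} - {y}"
    using adj_okD1(1)[OF assms(1,2)] adj_okD2(2)[OF assms(1)] assms(4) by fastforce
  from card_inj_on_le[OF adj_ok_inj[OF assms(1,2)] this] have "dg x \<le> card ({..<n} - {y})" by simp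
  then show ?thesis using assms(3) by simp
qed

lemma adj_ok_insert:
  assumes ok: "adj_ok n D dg ad ix" and x: "x < n" and y: "y < n" and xy: "(x, y) \<notin> D"
  shows "adj_ok n (insert (x, y) D) (dg(x := Suc (dg x))) (ad(x * n + dg x := y)) (ix(x * n + y := dg x))"
proof -
  have dx: "dg x < n" using adj_ok_deg_less[OF assms] .
  have 1: "(a, (ad(x * n + dg x := y)) (a * n + i)) \<in> insert (x, y) D \<and>
      (ix(x * n + y := dg x)) (a * n + (ad(x * n + dg x := y)) (a * n + i)) = i"
    if a: "a < n" and i: "i < (dg(x := Suc (dg x))) a" for a i
  proof (cases "a = x \<and> i = dg x")
    case False
    then have ia: "i < dg a" using i by (auto split: if_splits)
    then have "i < n" using adj_ok_deg_le[OF ok a] by simp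
    then have e: "(ad(x * n + dg x := y)) (a * n + i) = ad (a * n + i)"
      using False index_eq_iff[OF _ dx, of i a x] by auto
    have D: "(a, ad (a * n + i)) \<in> D" using adj_okD1[OF ok a ia] by blast
    then have "\<not> (a = x \<and> ad (a * n + i) = y)" using xy by auto
    then have "(ix(x * n + y := dg x)) (a * n + ad (a * n + i)) = ix (a * n + ad (a * n + i))"
      using index_eq_iff[OF adj_okD2(2)[OF ok D] y, of a x] by auto
    then show ?thesis using D e adj_okD1[OF ok a ia] by simp
  qed simp
  have 2: "a < n \<and> b < n \<and> (ix(x * n + y := dg x)) (a * n + b) < (dg(x := Suc (dg x))) a \<and>
      (ad(x * n + dg x := y)) (a * n + (ix(x * n + y := dg x)) (a * n + b)) = b"
    if ab: "(a, b) \<in> insert (x, y) D" for a b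
  proof (cases "(a, b) = (x, y)")
    case False
    then have D: "(a, b) \<in> D" using ab by auto
    note d = adj_okD2[OF ok D]
    have e: "(ix(x * n + y := dg x)) (a * n + b) = ix (a * n + b)"
      using False index_eq_iff[OF d(2) y, of a x] by auto
    have "ix (a * n + b) < n" using d(3) adj_ok_deg_le[OF ok d(1)] by simp
    then have "(ad(x * n + dg x := y)) (a * n + ix (a * n + b)) = ad (a * n + ix (a * n + b))"
      using d(3) index_eq_iff[OF _ dx, of "ix (a * n + b)" a x] by auto
    then show ?thesis using d e by auto
  qed (use x y in auto)
  show ?thesis unfolding adj_ok_def using 1 2 by blast
qed

text \<open>The last entry \<open>z\<close> of the row moves into the gap. If \<open>y\<close> is
  itself the last entry, then \<open>z = y\<close>, both array writes change nothing, and lowering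
  the degree does the removal.\<close>

lemma adj_ok_remove:
  assumes ok: "adj_ok n D dg ad ix" and xy: "(x, y) \<in> D"
  defines "i \<equiv> ix (x * n + y)" and "z \<equiv> ad (x * n + (dg x - 1))"
  shows "adj_ok n (D - {(x, y)}) (dg(x := dg x - 1)) (ad(x * n + i := z)) (ix(x * n + z := i))"
proof -
  note d = adj_okD2[OF ok xy, folded i_def]
  have dx: "dg x - 1 < dg x" using d(3) by simp
  have zD: "(x, z) \<in> D" and zi: "ix (x * n + z) = dg x - 1"
    using adj_okD1[OF ok d(1) dx] unfolding z_def by auto
  have zn: "z < n" using adj_okD2(2)[OF ok zD] .
  have i_n: "i < n" using d(3) adj_ok_deg_le[OF ok d(1)] by simp
  have 1: "(a, (ad(x * n + i := z)) (a * n + k)) \<in> D - {(x, y)} \<and>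
      (ix(x * n + z := i)) (a * n + (ad(x * n + i := z)) (a * n + k)) = k"
    if a: "a < n" and k: "k < (dg(x := dg x - 1)) a" for a k
  proof (cases "a = x \<and> k = i")
    case True
    then have "i < dg x - 1" using k by simp
    then have "z \<noteq> y" using zi i_def by auto
    then show ?thesis using True zD by simp
  next
    case False
    have ka: "k < dg a" using k by (auto split: if_splits)
    then have "k < n" using adj_ok_deg_le[OF ok a] by simp
    then have e: "(ad(x * n + i := z)) (a * n + k) = ad (a * n + k)"
      using False index_eq_iff[OF _ i_n, of k a x] by auto
    note D = adj_okD1[OF ok a ka]
    have "\<not> (a = x \<and> ad (a * n + k) = y)" using D(2) False i_def by auto
    moreover have "\<not> (a = x \<and> ad (a * n + k) = z)" using D(2) zi k by auto
    then have "(ix(x * n + z := i)) (a * n + ad (a * n + k)) = ix (a * n + ad (a * n + k))"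
      using index_eq_iff[OF adj_okD2(2)[OF ok D(1)] zn, of a x] by auto
    ultimately show ?thesis using D e by auto
  qed
  have 2: "a < n \<and> b < n \<and> (ix(x * n + z := i)) (a * n + b) < (dg(x := dg x - 1)) a \<and>
      (ad(x * n + i := z)) (a * n + (ix(x * n + z := i)) (a * n + b)) = b"
    if ab: "(a, b) \<in> D - {(x, y)}" for a b
  proof (cases "(a, b) = (x, z)")
    case True
    then have "z \<noteq> y" using ab by auto
    then have "i \<noteq> dg x - 1" using d(4) unfolding z_def by auto
    then show ?thesis using True d zn by auto
  next
    case False
    have D: "(a, b) \<in> D" "(a, b) \<noteq> (x, y)" using ab by auto
    note d' = adj_okD2[OF ok D(1)]
    have e: "(ix(x * n + z := i)) (a * n + b) = ix (a * n + b)"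
      using False index_eq_iff[OF d'(2) zn, of a x] by auto
    have "ix (a * n + b) < n" using d'(3) adj_ok_deg_le[OF ok d'(1)] by simp
    moreover have ne: "\<not> (a = x \<and> ix (a * n + b) = i)" using d'(4) d(4) D(2) by auto
    ultimately have "(ad(x * n + i := z)) (a * n + ix (a * n + b)) = ad (a * n + ix (a * n + b))"
      using index_eq_iff[OF _ i_n, of "ix (a * n + b)" a x] by auto
    moreover have "\<not> (a = x \<and> ix (a * n + b) = dg x - 1)" using False d'(4) unfolding z_def by auto
    then have "ix (a * n + b) < (dg(x := dg x - 1)) a" using d'(3) by auto
    ultimately show ?thesis using d' e by auto
  qed
  show ?thesis unfolding adj_ok_def using 1 2 by blast
qed

section \<open>Programs that insert and remove an arc\<close>

definition add_arc :: "name \<Rightarrow> name \<Rightarrow> com" where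
  "add_arc x y =
     Seq (Write ''adj'' (Plus (Times (Var x) (Var ''n'')) (Get ''deg'' (Var x))) (Var y))
    (Seq (Write ''ix'' (Plus (Times (Var x) (Var ''n'')) (Var y)) (Get ''deg'' (Var x)))
         (Write ''deg'' (Var x) (Plus (Get ''deg'' (Var x)) (Const 1))))"

definition remove_arc :: "name \<Rightarrow> name \<Rightarrow> com" where
  "remove_arc x y =
     Seq (Assign ''i'' (Get ''ix'' (Plus (Times (Var x) (Var ''n'')) (Var y))))
    (Seq (Assign ''z'' (Get ''adj'' (Plus (Times (Var x) (Var ''n'')) (Minus (Get ''deg'' (Var x)) (Const 1)))))
    (Seq (Write ''adj'' (Plus (Times (Var x) (Var ''n'')) (Var ''i'')) (Var ''z''))
    (Seq (Write ''ix'' (Plus (Times (Var x) (Var ''n'')) (Var ''z'')) (Var ''i''))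
         (Write ''deg'' (Var x) (Minus (Get ''deg'' (Var x)) (Const 1))))))"

definition same_args :: "state \<Rightarrow> state \<Rightarrow> bool" where
  "same_args s s' \<longleftrightarrow> (\<forall>x\<in>{''op'', ''u'', ''v''}. var s' x = var s x)"

definition represents :: "nat \<Rightarrow> (nat \<times> nat) set \<Rightarrow> state \<Rightarrow> bool" where
  "represents n D s \<longleftrightarrow> var s ''n'' = n \<and> bounded n s \<and>
     adj_ok n D (arr s ''deg'') (arr s ''adj'') (arr s ''ix'')"

lemma run_add_arc:
  assumes "represents n D s" "var s x < n" "var s y < n" "(var s x, var s y) \<notin> D"
  shows "run (word n) (add_arc x y) s (\<lambda>t s'. t \<le> 30 \<and> represents n (insert (var s x, var s y) D) s' \<and>
    same_args s s' \<and> arr s' ''mate'' = arr s ''mate'')"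
proof -
  have r: "var s ''n'' = n" "bounded n s" "adj_ok n D (arr s ''deg'') (arr s ''adj'') (arr s ''ix'')"
    using assms(1) by (auto simp: represents_def)
  have "arr s ''deg'' (var s x) < n" using adj_ok_deg_less[OF r(3) assms(2-4)] .
  then show ?thesis
    using r assms adj_ok_insert[OF r(3) assms(2-4)]
    by (simp add: add_arc_def run_simps represents_def fits_simps same_args_def)
qed

lemma run_remove_arc:
  assumes "represents n D s" "(var s x, var s y) \<in> D" "x \<in> {''u'', ''v''}" "y \<in> {''u'', ''v''}"
  shows "run (word n) (remove_arc x y) s (\<lambda>t s'. t \<le> 50 \<and> represents n (D - {(var s x, var s y)}) s' \<and>
    same_args s s' \<and> arr s' ''mate'' = arr s ''mate'')"
proof -
  have r: "var s ''n'' = n" "bounded n s" "adj_ok n D (arr s ''deg'') (arr s ''adj'') (arr s ''ix'')"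
    using assms(1) by (auto simp: represents_def)
  have b: "arr s ''deg'' (var s x) - Suc 0 \<le> n" using boundedD(2)[OF r(2)] by (meson diff_le_self le_trans)
  have ne: "x \<noteq> ''i''" "x \<noteq> ''z''" "y \<noteq> ''i''" "y \<noteq> ''z''" using assms(3,4) by auto
  show ?thesis
    using r b ne adj_ok_remove[OF r(3) assms(2)]
    by (simp add: remove_arc_def run_simps represents_def fits_simps same_args_def)
qed

section \<open>Alternating search\<close>

text \<open>The queue \<open>q\<close> holds the vertices reached from \<open>r\<close> by alternating paths of even length,
  \<open>par\<close> the queue positions of their predecessors. A vertex \<open>z\<close> is in the queue iff
  \<open>pos z < l \<and> q (pos z) = z\<close>, so that stale entries of \<open>pos\<close> need not be cleared
  between two searches.\<close>

definition bfs :: "nat \<Rightarrow> nat set \<Rightarrow> nat set set \<Rightarrow> (nat \<Rightarrow> nat) \<Rightarrow> (nat \<Rightarrow> nat) \<Rightarrow> (nat \<Rightarrow> nat) \<Rightarrow> nat \<Rightarrow>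
    (nat \<Rightarrow> nat) \<Rightarrow> (nat \<Rightarrow> nat) \<Rightarrow> (nat \<Rightarrow> nat) \<Rightarrow> nat \<Rightarrow> nat \<Rightarrow> nat \<Rightarrow> nat \<Rightarrow> nat \<Rightarrow> bool" where
  "bfs n S E mt dg ad r q pos par l j i f y \<longleftrightarrow>
     1 \<le> l \<and> j \<le> l \<and> q 0 = r \<and>
     (\<forall>k<l. q k < n \<and> q k \<in> S \<and> pos (q k) = k) \<and>
     (\<forall>k<l. 0 < k \<longrightarrow> par k < k \<and> (\<exists>w. mt (q k) = Suc w \<and> {q (par k), w} \<in> E)) \<and>
     (\<forall>k<j. \<forall>m<dg (q k). \<exists>k'<l. mt (ad (q k * n + m)) = Suc (q k')) \<and>
     (f = 0 \<longrightarrow> j < l \<longrightarrow> i \<le> dg (q j) \<and> (\<forall>m<i. \<exists>k'<l. mt (ad (q j * n + m)) = Suc (q k'))) \<and>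
     (f \<noteq> 0 \<longrightarrow> j < l \<and> {q j, y} \<in> E \<and> mt y = 0)"

lemma bfsD:
  assumes "bfs n S E mt dg ad r q pos par l j i f y"
  shows "1 \<le> l" "j \<le> l" "q 0 = r"
    and "\<And>k. k < l \<Longrightarrow> q k < n" "\<And>k. k < l \<Longrightarrow> q k \<in> S" "\<And>k. k < l \<Longrightarrow> pos (q k) = k"
    and "\<And>k. k < l \<Longrightarrow> 0 < k \<Longrightarrow> par k < k"
    and "\<And>k. k < l \<Longrightarrow> 0 < k \<Longrightarrow> \<exists>w. mt (q k) = Suc w \<and> {q (par k), w} \<in> E"
    and "\<And>k m. k < j \<Longrightarrow> m < dg (q k) \<Longrightarrow> \<exists>k'<l. mt (ad (q k * n + m)) = Suc (q k')"
    and "f = 0 \<Longrightarrow> j < l \<Longrightarrow> i \<le> dg (q j)"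
    and "\<And>m. f = 0 \<Longrightarrow> j < l \<Longrightarrow> m < i \<Longrightarrow> \<exists>k'<l. mt (ad (q j * n + m)) = Suc (q k')"
    and "f \<noteq> 0 \<Longrightarrow> j < l \<and> {q j, y} \<in> E \<and> mt y = 0"
  using assms unfolding bfs_def by auto

lemma bfs_inj: "bfs n S E mt dg ad r q pos par l j i f y \<Longrightarrow> inj_on q {..<l}"
  by (rule inj_on_inverseI[where g = pos]) (simp add: bfsD(6))

lemma bfs_init:
  assumes "r < n" "r \<in> S"
  shows "bfs n S E mt dg ad r (q(0 := r)) (pos(r := 0)) par 1 0 0 0 y"
  using assms by (simp add: bfs_def)

lemma bfs_found:
  assumes "bfs n S E mt dg ad r q pos par l j i 0 y" "j < l" "{q j, w} \<in> E" "mt w = 0"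
  shows "bfs n S E mt dg ad r q pos par l j i 1 w"
  using assms by (simp add: bfs_def)

lemma bfs_next:
  assumes "bfs n S E mt dg ad r q pos par l j i 0 y" "j < l" "dg (q j) \<le> i"
  shows "bfs n S E mt dg ad r q pos par l (Suc j) 0 0 y"
  using assms unfolding bfs_def by (auto simp: less_Suc_eq)

lemma bfs_old:
  assumes "bfs n S E mt dg ad r q pos par l j i 0 y" "j < l" "i < dg (q j)"
    and "mt (ad (q j * n + i)) = Suc z" "pos z < l" "q (pos z) = z"
  shows "bfs n S E mt dg ad r q pos par l j (Suc i) 0 w"
proof -
  have "\<exists>k'<l. mt (ad (q j * n + i)) = Suc (q k')" using assms(4-6) by metis
  then show ?thesis using assms(1-3) unfolding bfs_def by (auto simp: less_Suc_eq)
qed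

text \<open>An edge of \<open>E\<close> followed by a matching edge leads back to the side
  \<open>S\<close>, so \<open>z\<close> may join the queue. As \<open>z\<close> was not in it, the
  old queue misses a vertex below \<open>n\<close>.\<close>

lemma bfs_new:
  assumes b: "bfs n S E mt dg ad r q pos par l j i 0 y" and j: "j < l" and i: "i < dg (q j)"
    and mz: "mt (ad (q j * n + i)) = Suc z" and new: "\<not> (pos z < l \<and> q (pos z) = z)"
    and two: "two_coloured n S E" and mok: "mate_ok E mt" and e: "{q j, ad (q j * n + i)} \<in> E"
  shows "bfs n S E mt dg ad r (q(l := z)) (pos(z := l)) (par(l := j)) (Suc l) j (Suc i) 0 w"
    and "l < n"
proof -
  note d = bfsD[OF b]
  let ?w = "ad (q j * n + i)"
  have zw: "mt z = Suc ?w" "{?w, z} \<in> E" using mate_okD[OF mok mz] by auto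
  have z: "z < n" "z \<in> S"
    using two_coloured_edge[OF two zw(2)] two_coloured_edge[OF two e] d(5)[OF j] by auto
  \<comment> \<open>\<open>pos\<close> is correct for every queued vertex, so the membership test
    fails only for vertices outside the queue.\<close>
  have nq: "q k \<noteq> z" if "k < l" for k using new d(6)[OF that] that by auto
  \<comment> \<open>Rewriting the coverage clauses in this way reduces them to the old queue and the
    single new vertex \<open>z\<close>.\<close>
  have ext: "(\<exists>k'<Suc l. mt v = Suc ((q(l := z)) k')) \<longleftrightarrow> (\<exists>k'<l. mt v = Suc (q k')) \<or> mt v = Suc z" for v
    by (auto simp: less_Suc_eq)
  show "bfs n S E mt dg ad r (q(l := z)) (pos(z := l)) (par(l := j)) (Suc l) j (Suc i) 0 w"
    unfolding bfs_def ext
  proof (intro conjI allI impI)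
    show "1 \<le> Suc l" "j \<le> Suc l" "(q(l := z)) 0 = r" using d(1-3) by auto
    fix k
    show "(q(l := z)) k < n" "(q(l := z)) k \<in> S" "(pos(z := l)) ((q(l := z)) k) = k" if "k < Suc l"
      using that z d(4-6)[of k] nq[of k] by (auto simp: less_Suc_eq)
    show "(par(l := j)) k < k"
      "\<exists>w. mt ((q(l := z)) k) = Suc w \<and> {(q(l := z)) ((par(l := j)) k), w} \<in> E" if "k < Suc l" "0 < k"
      using that j zw(1) e d(7,8)[of k] by (auto simp: less_Suc_eq)
    show "(\<exists>k'<l. mt (ad ((q(l := z)) k * n + m)) = Suc (q k')) \<or> mt (ad ((q(l := z)) k * n + m)) = Suc z"
      if "k < j" "m < dg ((q(l := z)) k)" for m
      using that j d(9)[of k m] by auto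
    show "Suc i \<le> dg ((q(l := z)) j)" using i j by simp
    show "(\<exists>k'<l. mt (ad ((q(l := z)) j * n + m)) = Suc (q k')) \<or> mt (ad ((q(l := z)) j * n + m)) = Suc z"
      if "m < Suc i" for m
      using that j mz d(11)[of m] by (auto simp: less_Suc_eq)
  qed auto
  have "q ` {..<l} \<subseteq> {..<n} - {z}" using d(4) nq by auto
  from card_inj_on_le[OF bfs_inj[OF b] this] have "l \<le> card ({..<n} - {z})" by simp
  then show "l < n" using z by simp
qed

text \<open>The counted vertices are distinct: in the queue because of \<open>pos\<close>, in an
  adjacency row because of \<open>ix\<close>.\<close>

lemma bfs_bounds:
  assumes b: "bfs n S E mt dg ad r q pos par l j i f y"
    and two: "two_coloured n S E" and mok: "mate_ok E mt"
    and ok: "adj_ok n D dg ad ix"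
  shows "l \<le> n" "l \<le> 2 * card (pairs mt) + 1"
    and "f = 0 \<Longrightarrow> j < l \<Longrightarrow> i \<le> 2 * card (pairs mt)"
proof -
  note d = bfsD[OF b]
  let ?C = "{x. mt x \<noteq> 0}"
  have C: "finite ?C" "card ?C \<le> 2 * card (pairs mt)"
    using card_matched[OF two_coloured_finite[OF two] mok] .
  have "q ` {..<l} \<subseteq> {..<n}" using d(4) by auto
  from card_inj_on_le[OF bfs_inj[OF b] this] show "l \<le> n" by simp
  have "q ` {1..<l} \<subseteq> ?C" using d(8) by fastforce
  moreover have "inj_on q {1..<l}" using bfs_inj[OF b] by (rule inj_on_subset) auto
  ultimately have "card {1..<l} \<le> card ?C" using C(1) by (metis card_inj_on_le)
  then show "l \<le> 2 * card (pairs mt) + 1" using C(2) by simp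
  assume f: "f = 0" "j < l"
  have "(\<lambda>m. ad (q j * n + m)) ` {..<i} \<subseteq> ?C" using d(11)[OF f] by fastforce
  moreover have "inj_on (\<lambda>m. ad (q j * n + m)) {..<i}"
    using adj_ok_inj[OF ok d(4)[OF f(2)]] by (rule inj_on_subset) (use d(10)[OF f] in auto)
  ultimately have "card {..<i} \<le> card ?C" using C(1) by (metis card_inj_on_le)
  then show "i \<le> 2 * card (pairs mt)" using C(2) by simp
qed

lemma bfs_blocked:
  assumes b: "bfs n S E mt dg ad r q pos par l j i 0 y" and j: "\<not> j < l"
    and two: "two_coloured n S E" and mok: "mate_ok E mt"
    and ok: "adj_ok n {(x, y). {x, y} \<in> E} dg ad ix"
  shows "blocked E mt r"
proof -
  note d = bfsD[OF b]
  \<comment> \<open>With the vertices matched into the queue as \<open>A\<close>, saturation is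
    immediate. Disjointness from the queue comes from the colouring, and containment of all
    neighbours from the exhausted scan.\<close>
  let ?A = "{w. \<exists>k<l. mt w = Suc (q k)}"
  have A: "{w, q k} \<in> E" if "mt w = Suc (q k)" for w k using mate_okD[OF mok that] ..
  show ?thesis unfolding blocked_def
  proof (intro exI conjI)
    show "r \<in> q ` {..<l}" using d(1,3) by force
    show "q ` {..<l} \<inter> ?A = {}"
    proof (rule ccontr)
      assume "q ` {..<l} \<inter> ?A \<noteq> {}"
      then obtain k k' where "k < l" "k' < l" "mt (q k) = Suc (q k')" by auto
      then show False using two_coloured_edge(3)[OF two A[of "q k" k']] d(5) by auto
    qed
    show "finite ?A" using A two_coloured_edge(1)[OF two] by (intro finite_subset[of ?A "{..<n}"]) auto
    show "\<forall>x\<in>q ` {..<l}. \<forall>y. {x, y} \<in> E \<longrightarrow> y \<in> ?A"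
    proof (intro ballI allI impI)
      fix x w assume "x \<in> q ` {..<l}" and e: "{x, w} \<in> E"
      then obtain k where k: "k < l" "x = q k" by auto
      have "(x, w) \<in> {(x, y). {x, y} \<in> E}" using e by simp
      note ix = adj_okD2[OF ok this]
      show "w \<in> ?A" using d(9)[of k "ix (x * n + w)"] ix k j by simp
    qed
    show "\<forall>y\<in>?A. \<exists>x\<in>q ` {..<l}. mt y = Suc x" by auto
  qed
qed

section \<open>Flipping an alternating path\<close>

text \<open>The flip runs from the free end towards the root. While \<open>f\<close> is nonzero, the
  queue up to position \<open>j\<close> still has its original mates, so \<open>par\<close>
  describes a valid path for the part not yet flipped. The branch \<open>f = 0\<close> is the state
  on exit: a free root has been matched, or the former mate of a matched root is now free.\<close>

definition flip_inv :: "nat set set \<Rightarrow> (nat \<Rightarrow> nat) \<Rightarrow> (nat \<Rightarrow> nat) \<Rightarrow> nat \<Rightarrow> nat \<Rightarrow> nat \<Rightarrow> nat \<Rightarrow> nat \<Rightarrow>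
    (nat \<Rightarrow> nat) \<Rightarrow> bool" where
  "flip_inv E m\<^sub>0 q l r j f y mt \<longleftrightarrow> mate_ok E mt \<and>
     (if f = 0 then card (pairs mt) = card (pairs m\<^sub>0) + (if m\<^sub>0 r = 0 then 1 else 0) \<and>
          (\<forall>u. m\<^sub>0 r = Suc u \<longrightarrow> mt u = 0)
      else card (pairs mt) = card (pairs m\<^sub>0) \<and> j < l \<and> {q j, y} \<in> E \<and> mt y = 0 \<and>
          (\<forall>k\<le>j. mt (q k) = m\<^sub>0 (q k)))"

text \<open>Besides \<open>q j\<close>, rematching touches only \<open>y\<close> and the old mate of
  \<open>q j\<close>, both outside \<open>S\<close>. Since \<open>par j < j\<close>, the even
  vertices that remain on the path are unaffected.\<close>

lemma flip_step:
  assumes b: "bfs n S E m\<^sub>0 dg ad r q pos par l j\<^sub>0 i f\<^sub>0 y\<^sub>0" and two: "two_coloured n S E"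
    and inv: "flip_inv E m\<^sub>0 q l r j 1 y mt"
  shows "j = 0 \<Longrightarrow> flip_inv E m\<^sub>0 q l r j' 0 y' (rematch (q j) y mt)"
    and "0 < j \<Longrightarrow> flip_inv E m\<^sub>0 q l r (par j) 1 (mt (q j) - 1) (rematch (q j) y mt)"
proof -
  note d = bfsD[OF b]
  have mok: "mate_ok E mt" and card: "card (pairs mt) = card (pairs m\<^sub>0)" and j: "j < l"
    and e: "{q j, y} \<in> E" and y: "mt y = 0" and eq: "\<And>k. k \<le> j \<Longrightarrow> mt (q k) = m\<^sub>0 (q k)"
    using inv by (auto simp: flip_inv_def)
  have ys: "y \<notin> S" "q j \<noteq> y" using two_coloured_edge[OF two e] d(5)[OF j] by auto
  have loop: "mt x \<noteq> Suc x" for x using mate_okD[OF mok] two_coloured_edge(4)[OF two] by blast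
  note re = rematch[OF two_coloured_finite[OF two] mok y ys(2) e loop]
  have freed: "w \<noteq> q j \<and> rematch (q j) y mt w = 0 \<and> w \<notin> S" if w: "mt (q j) = Suc w" for w
  proof -
    have "w \<noteq> q j" "w \<noteq> y" "{q j, w} \<in> E" using mate_okD[OF mok w] y w loop[of "q j"] by auto
    then show ?thesis
      using w two_coloured_edge(3)[OF two, of "q j" w] d(5)[OF j] by (simp add: rematch_def)
  qed
  show "flip_inv E m\<^sub>0 q l r j' 0 y' (rematch (q j) y mt)" if "j = 0"
    using re card eq[of j] freed d(3) that by (simp add: flip_inv_def)
  assume j0: "0 < j"
  obtain w where w: "m\<^sub>0 (q j) = Suc w" "{q (par j), w} \<in> E" using d(8)[OF j j0] by blast
  have mw: "mt (q j) = Suc w" using eq[of j] w by simp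
  have pj: "par j < j" using d(7)[OF j j0] .
  have "rematch (q j) y mt (q k) = m\<^sub>0 (q k)" if k: "k \<le> par j" for k
  proof -
    have kl: "k < l" "k < j" using k pj j by auto
    then have "q k \<noteq> q j" using d(6)[of k] d(6)[of j] j by auto
    moreover have "q k \<noteq> w" "q k \<noteq> y" using d(5)[OF kl(1)] freed[OF mw] ys by auto
    ultimately show ?thesis using mw eq[of k] kl by (simp add: rematch_def)
  qed
  then show "flip_inv E m\<^sub>0 q l r (par j) 1 (mt (q j) - 1) (rematch (q j) y mt)"
    using re card mw w pj j freed[OF mw] by (simp add: flip_inv_def)
qed

section \<open>The search program and its cost\<close>

definition visit :: com where
  "visit =
     Cond (Conj (Less (Get ''pos'' (Var ''z'')) (Var ''l''))
                (Equal (Get ''q'' (Get ''pos'' (Var ''z''))) (Var ''z'')))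
       Skip
       (Seq (Write ''q'' (Var ''l'') (Var ''z''))
       (Seq (Write ''pos'' (Var ''z'') (Var ''l''))
       (Seq (Write ''par'' (Var ''l'') (Var ''j''))
            (Assign ''l'' (Plus (Var ''l'') (Const 1))))))"

text \<open>A round either inspects one list entry or moves to the next queue position. Merging the
  two nested loops in this way lets a single potential account for both.\<close>

definition scan :: com where
  "scan =
     Seq (Assign ''x'' (Get ''q'' (Var ''j'')))
    (Cond (Less (Var ''i'') (Get ''deg'' (Var ''x'')))
      (Seq (Assign ''y'' (Get ''adj'' (Plus (Times (Var ''x'') (Var ''n'')) (Var ''i''))))
      (Cond (Equal (Get ''mate'' (Var ''y'')) (Const 0))
        (Assign ''f'' (Const 1))
        (Seq (Assign ''z'' (Minus (Get ''mate'' (Var ''y'')) (Const 1)))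
        (Seq visit
             (Assign ''i'' (Plus (Var ''i'') (Const 1)))))))
      (Seq (Assign ''j'' (Plus (Var ''j'') (Const 1)))
           (Assign ''i'' (Const 0))))"

definition scan_guard :: bexp where
  "scan_guard = Conj (Less (Var ''j'') (Var ''l'')) (Equal (Var ''f'') (Const 0))"

text \<open>\<open>z\<close> saves the old entry of \<open>x\<close>, which is overwritten before
  the next free end is computed from it.\<close>

definition flip :: com where
  "flip =
     Seq (Assign ''x'' (Get ''q'' (Var ''j'')))
    (Seq (Assign ''z'' (Get ''mate'' (Var ''x'')))
    (Seq (Cond (Less (Const 0) (Var ''z''))
           (Write ''mate'' (Minus (Var ''z'') (Const 1)) (Const 0))
           Skip)
    (Seq (Write ''mate'' (Var ''x'') (Plus (Var ''y'') (Const 1)))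
    (Seq (Write ''mate'' (Var ''y'') (Plus (Var ''x'') (Const 1)))
         (Cond (Equal (Var ''j'') (Const 0))
           (Assign ''f'' (Const 0))
           (Seq (Assign ''y'' (Minus (Var ''z'') (Const 1)))
                (Assign ''j'' (Get ''par'' (Var ''j'')))))))))"

definition search_init :: com where
  "search_init =
     Seq (Write ''q'' (Const 0) (Var ''r''))
    (Seq (Write ''pos'' (Var ''r'') (Const 0))
    (Seq (Assign ''l'' (Const 1))
    (Seq (Assign ''j'' (Const 0))
    (Seq (Assign ''i'' (Const 0))
         (Assign ''f'' (Const 0))))))"

text \<open>After a failed scan \<open>f\<close> is 0, so the guard of the flipping loop also serves
  as the test for success.\<close>

definition search :: com where
  "search = Seq search_init (Seq (While scan_guard scan) (While (Equal (Var ''f'') (Const 1)) flip))"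

definition same_graph :: "state \<Rightarrow> state \<Rightarrow> bool" where
  "same_graph s s' \<longleftrightarrow> same_args s s' \<and> var s' ''n'' = var s ''n'' \<and>
     (\<forall>a\<in>{''deg'', ''adj'', ''ix''}. arr s' a = arr s a)"

lemma same_graphD:
  assumes "same_graph s s'"
  shows "same_args s s'" "var s' ''n'' = var s ''n''"
    "arr s' ''deg'' = arr s ''deg''" "arr s' ''adj'' = arr s ''adj''" "arr s' ''ix'' = arr s ''ix''"
  using assms by (auto simp: same_graph_def)

lemma same_graph_set_var [simp]:
  "same_graph s s' \<Longrightarrow> x \<notin> {''n'', ''op'', ''u'', ''v''} \<Longrightarrow> same_graph s (set_var x k s')"
  by (auto simp: same_graph_def same_args_def)

lemma same_graph_set_arr [simp]:
  "same_graph s s' \<Longrightarrow> a \<notin> {''deg'', ''adj'', ''ix''} \<Longrightarrow> same_graph s (set_arr a i k s')"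
  by (auto simp: same_graph_def same_args_def)

abbreviation arcs :: "nat set set \<Rightarrow> (nat \<times> nat) set" where
  "arcs E \<equiv> {(x, y). {x, y} \<in> E}"

definition bfs_state :: "nat \<Rightarrow> nat set \<Rightarrow> nat set set \<Rightarrow> nat \<Rightarrow> state \<Rightarrow> state \<Rightarrow> bool" where
  "bfs_state n S E r s\<^sub>0 s \<longleftrightarrow> bounded n s \<and> same_graph s\<^sub>0 s \<and> arr s ''mate'' = arr s\<^sub>0 ''mate'' \<and>
     bfs n S E (arr s ''mate'') (arr s ''deg'') (arr s ''adj'') r
       (arr s ''q'') (arr s ''pos'') (arr s ''par'')
       (var s ''l'') (var s ''j'') (var s ''i'') (var s ''f'') (var s ''y'') \<and> var s ''f'' \<le> 1"

text \<open>A bound on the remaining rounds, at 80 units each. There are at most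
  \<open>2 * m + 1\<close> queue positions, each with at most \<open>2 * m\<close> rounds that
  advance \<open>i\<close> and one that ends the list; the weight \<open>2 * m + 3\<close> covers
  these with some slack. The last summand pays for the round that sets \<open>f\<close>.\<close>

definition scan_potential :: "nat \<Rightarrow> state \<Rightarrow> nat" where
  "scan_potential m s =
     80 * ((2 * m + 1 - var s ''j'') * (2 * m + 3) - var s ''i'' + (1 - var s ''f''))"

text \<open>One inequality for each outcome of a round: a free neighbour, the next entry, the next
  position. They rest on \<open>P' + 3 + i \<le> P\<close>, which also keeps the truncated
  subtractions exact.\<close>

lemma scan_potential_simps:
  assumes "j < l" "l \<le> 2 * m + 1" "i \<le> 2 * m"
  shows "80 + 80 * ((2 * m + 1 - j) * (2 * m + 3) - i) \<le> 80 * ((2 * m + 1 - j) * (2 * m + 3) - i + 1)"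
    and "80 + 80 * ((2 * m + 1 - j) * (2 * m + 3) - Suc i + 1) \<le> 80 * ((2 * m + 1 - j) * (2 * m + 3) - i + 1)"
    and "80 + 80 * ((2 * m + 1 - Suc j) * (2 * m + 3) + 1) \<le> 80 * ((2 * m + 1 - j) * (2 * m + 3) - i + 1)"
proof -
  define P P' where P: "P = (2 * m + 1 - j) * (2 * m + 3)" and P': "P' = (2 * m + 1 - Suc j) * (2 * m + 3)"
  have "2 * m + 1 - j = Suc (2 * m + 1 - Suc j)" using assms by simp
  then have PP': "P = P' + (2 * m + 3)" unfolding P P' by (simp only: mult_Suc add.commute)
  have "P' + 3 + i \<le> P" using PP' assms(3) by linarith
  then obtain k where "P = P' + 3 + i + k" unfolding le_iff_add by blast
  then have "80 + 80 * (P - i) \<le> 80 * (P - i + 1) \<and> 80 + 80 * (P - Suc i + 1) \<le> 80 * (P - i + 1) \<and>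
      80 + 80 * (P' + 1) \<le> 80 * (P - i + 1)"
    by simp
  then show "80 + 80 * ((2 * m + 1 - j) * (2 * m + 3) - i) \<le> 80 * ((2 * m + 1 - j) * (2 * m + 3) - i + 1)"
    "80 + 80 * ((2 * m + 1 - j) * (2 * m + 3) - Suc i + 1) \<le> 80 * ((2 * m + 1 - j) * (2 * m + 3) - i + 1)"
    "80 + 80 * ((2 * m + 1 - Suc j) * (2 * m + 3) + 1) \<le> 80 * ((2 * m + 1 - j) * (2 * m + 3) - i + 1)"
    unfolding P P' by blast+
qed

lemma run_scan:
  assumes st: "bfs_state n S E r s\<^sub>0 s" and guard: "bval scan_guard s"
    and rep: "represents n (arcs E) s\<^sub>0" and mok: "mate_ok E (arr s\<^sub>0 ''mate'')"
    and two: "two_coloured n S E" and m: "m = card (pairs (arr s\<^sub>0 ''mate''))"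
  shows "run (word n) scan s (\<lambda>t s'. bfs_state n S E r s\<^sub>0 s' \<and>
    1 + bcost scan_guard + t + scan_potential m s' \<le> scan_potential m s)"
proof -
  let ?mt = "arr s ''mate''" and ?q = "arr s ''q''" and ?j = "var s ''j''" and ?i = "var s ''i''"
    and ?l = "var s ''l''" and ?dg = "arr s ''deg''" and ?ad = "arr s ''adj''" and ?pos = "arr s ''pos''"
  have jl: "?j < ?l" and f: "var s ''f'' = 0" using guard by (auto simp: scan_guard_def)
  have sg: "same_graph s\<^sub>0 s" and bd: "bounded n s" and mt: "?mt = arr s\<^sub>0 ''mate''"
    using st by (auto simp: bfs_state_def)
  have b: "bfs n S E ?mt ?dg ?ad r ?q ?pos (arr s ''par'') ?l ?j ?i 0 (var s ''y'')"
    using st f by (auto simp: bfs_state_def)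
  have vn: "var s ''n'' = n" and ok: "adj_ok n (arcs E) ?dg ?ad (arr s ''ix'')"
    using rep same_graphD[OF sg] by (auto simp: represents_def)
  have mok': "mate_ok E ?mt" using mok mt by simp
  note bounds = bfs_bounds[OF b two mok' ok, folded mt m]
  have il: "?i \<le> 2 * m" "?l \<le> 2 * m + 1" "?l \<le> n" using bounds jl mt m by auto
  note pot = scan_potential_simps[OF jl il(2,1)]
  have qn: "?q ?j < n" using bfsD(4)[OF b jl] .
  have dn: "?dg (?q ?j) \<le> n" using adj_ok_deg_le[OF ok qn] .
  have jn: "Suc ?j \<le> n" using jl il by simp
  note simps = scan_def scan_guard_def run_simps fits_simps bd vn sg mt[symmetric] f
    bfs_state_def scan_potential_def
  show ?thesis
  proof (cases "?i < ?dg (?q ?j)")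
    case False
    then have "bfs n S E ?mt ?dg ?ad r ?q ?pos (arr s ''par'') ?l (Suc ?j) 0 0 (var s ''y'')"
      using bfs_next[OF b jl] by simp
    then show ?thesis using False jn pot(3) by (simp add: simps)
  next
    case True
    let ?w = "?ad (?q ?j * n + ?i)"
    have e: "{?q ?j, ?w} \<in> E" using adj_okD1(1)[OF ok qn True] by simp
    have i_n: "Suc ?i \<le> n" using True dn by simp
    show ?thesis
    proof (cases "?mt ?w")
      case 0
      have "bfs n S E ?mt ?dg ?ad r ?q ?pos (arr s ''par'') ?l ?j ?i 1 ?w"
        using bfs_found[OF b jl e 0] .
      then show ?thesis using True 0 pot(1) jn by (simp add: simps)
    next
      case (Suc z)
      have "Suc z \<le> n" using boundedD(2)[OF bd, of "''mate''" ?w] Suc by simp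
      then have zn: "z \<le> n" "z < word n" "Suc z < word n" by (auto intro: word_less)
      show ?thesis
      proof (cases "?pos z < ?l \<and> ?q (?pos z) = z")
        case visited: True
        have "bfs n S E ?mt ?dg ?ad r ?q ?pos (arr s ''par'') ?l ?j (Suc ?i) 0 ?w"
          using bfs_old[OF b jl True Suc] visited by blast
        then show ?thesis using True Suc visited zn i_n jn pot(2) by (simp add: simps visit_def)
      next
        case new: False
        note bn = bfs_new(1)[OF b jl True Suc new two mok' e, of ?w] bfs_new(2)[OF b jl True Suc new two mok' e]
        then show ?thesis using True Suc new zn i_n jn pot(2) by (auto simp: simps visit_def)
      qed
    qed
  qed
qed

text \<open>The facts about the queue refer to the array \<open>m\<^sub>0\<close> from before the
  flip, because flipping changes matching edges of the search tree. In the potential,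
  \<open>j\<close> drops along \<open>par\<close>, and \<open>f\<close> pays for the last round, at
  \<open>j = 0\<close>. The summand 4 is the cost of the loop guard.\<close>

lemma run_flip:
  assumes b: "bfs n S E m\<^sub>0 dg ad r (arr s ''q'') pos (arr s ''par'') l j\<^sub>0 i f\<^sub>0 y\<^sub>0"
    and two: "two_coloured n S E" and bd: "bounded n s" and f: "var s ''f'' = 1"
    and inv: "flip_inv E m\<^sub>0 (arr s ''q'') l r (var s ''j'') (var s ''f'') (var s ''y'') (arr s ''mate'')"
  shows "run (word n) flip s (\<lambda>t s'. bounded n s' \<and>
    (\<forall>s\<^sub>0. same_graph s\<^sub>0 s \<longrightarrow> same_graph s\<^sub>0 s') \<and>
    arr s' ''q'' = arr s ''q'' \<and> arr s' ''par'' = arr s ''par'' \<and> var s' ''f'' \<le> 1 \<and>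
    flip_inv E m\<^sub>0 (arr s ''q'') l r (var s' ''j'') (var s' ''f'') (var s' ''y'') (arr s' ''mate'') \<and>
    4 + t + 60 * (var s' ''j'' + var s' ''f'') \<le> 60 * (var s ''j'' + var s ''f''))"
proof -
  let ?j = "var s ''j''" and ?q = "arr s ''q''" and ?y = "var s ''y''" and ?mt = "arr s ''mate''"
  have inv1: "flip_inv E m\<^sub>0 ?q l r ?j 1 ?y ?mt" using inv f by simp
  note step = flip_step[OF b two inv1]
  have j: "?j < l" and e: "{?q ?j, ?y} \<in> E" using inv1 by (auto simp: flip_inv_def)
  have yn: "Suc ?y \<le> n" "Suc (?q ?j) \<le> n" using two_coloured_edge[OF two e] by auto
  then have n1: "Suc 0 \<le> n" by simp
  have zn: "?mt (?q ?j) - Suc 0 \<le> n" using boundedD(2)[OF bd, of "''mate''" "?q ?j"] by simp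
  have pj: "arr s ''par'' ?j < ?j" if "0 < ?j" using bfsD(7)[OF b j that] .
  note simps = flip_def run_simps fits_simps bd f yn zn n1 rematch_def
  show ?thesis
  proof (cases "?j = 0")
    case True
    show ?thesis
      using True step(1)[OF True, of 0 ?y] yn zn by (cases "?mt (?q 0) = 0") (simp_all add: simps)
  next
    case False
    then have "0 < ?j" by simp
    then show ?thesis
      using step(2) pj by (cases "?mt (?q ?j) = 0") (simp_all add: simps)
  qed
qed

definition stored :: "nat \<Rightarrow> nat set set \<Rightarrow> state \<Rightarrow> bool" where
  "stored n E s \<longleftrightarrow> represents n (arcs E) s \<and> mate_ok E (arr s ''mate'')"

lemma same_args_trans: "same_args s s' \<Longrightarrow> same_args s' s'' \<Longrightarrow> same_args s s''"
  by (simp add: same_args_def)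

lemma run_search_aux:
  assumes st: "stored n E s" and two: "two_coloured n S E" and r: "var s ''r'' < n" "var s ''r'' \<in> S"
    and m: "m = card (pairs (arr s ''mate''))"
  shows "run (word n) search s (\<lambda>t s'. t \<le> 500 * (m + 1)\<^sup>2 \<and> stored n E s' \<and> same_args s s' \<and>
    (arr s' ''mate'' = arr s ''mate'' \<and> blocked E (arr s ''mate'') (var s ''r'') \<or>
     card (pairs (arr s' ''mate'')) = m + (if arr s ''mate'' (var s ''r'') = 0 then 1 else 0) \<and>
     (\<forall>u. arr s ''mate'' (var s ''r'') = Suc u \<longrightarrow> arr s' ''mate'' u = 0)))"
    (is "run _ _ _ (\<lambda>t s'. _ \<and> ?post s')")
proof -
  let ?mt = "arr s ''mate''" and ?r = "var s ''r''"
  let ?st = "bfs_state n S E ?r s"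
  have rep: "represents n (arcs E) s" and mok: "mate_ok E ?mt" using st by (auto simp: stored_def)
  have bd: "bounded n s" and vn: "var s ''n'' = n" using rep by (auto simp: represents_def)
  have n1: "Suc 0 \<le> n" using r by simp
  have rn: "?r \<le> n" "?r < word n" using r by (auto intro: word_less)
  have sgs: "same_graph s s" by (simp add: same_graph_def same_args_def)
  have 1: "run (word n) search_init s (\<lambda>t s'. t \<le> 30 \<and> ?st s' \<and> scan_potential m s' \<le> 320 * (m + 1)\<^sup>2)"
  proof -
    \<comment> \<open>Equality holds: \<open>(2 * m + 1) * (2 * m + 3) + 1\<close> is
      \<open>4 * (m + 1)\<^sup>2\<close>.\<close>
    have "80 * ((2 * m + 1) * (2 * m + 3) + 1) \<le> 320 * (m + 1)\<^sup>2"
      by (simp add: power2_eq_square algebra_simps)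
    then show ?thesis using bfs_init[OF r]
      by (simp add: search_init_def run_simps fits_simps bd n1 rn sgs bfs_state_def scan_potential_def)
  qed
  have 2: "run (word n) (While scan_guard scan) s1 (\<lambda>t s'. ?st s' \<and> \<not> bval scan_guard s' \<and>
      t + scan_potential m s' \<le> scan_potential m s1 + 1 + bcost scan_guard)" if "?st s1" for s1
  proof (rule run_While[where I = "?st"])
    show "?st s1" by fact
    show "bfits (word n) scan_guard s'" if "?st s'" for s'
      using that by (simp add: scan_guard_def fits_simps bfs_state_def)
    show "run (word n) scan s' (\<lambda>t s''. ?st s'' \<and>
        1 + bcost scan_guard + t + scan_potential m s'' \<le> scan_potential m s')"
      if "?st s'" "bval scan_guard s'" for s'
      using run_scan[OF that rep mok two m] .
  qed
  have 3: "run (word n) (While (Equal (Var ''f'') (Const 1)) flip) s2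
      (\<lambda>t s'. t \<le> 120 * (m + 1)\<^sup>2 + 4 \<and> ?post s')"
    if s2: "?st s2" and ng: "\<not> bval scan_guard s2" for s2
  proof -
    have sg: "same_graph s s2" and bd2: "bounded n s2" and mt2: "arr s2 ''mate'' = ?mt"
      using s2 by (auto simp: bfs_state_def)
    have b: "bfs n S E ?mt (arr s2 ''deg'') (arr s2 ''adj'') ?r (arr s2 ''q'') (arr s2 ''pos'')
        (arr s2 ''par'') (var s2 ''l'') (var s2 ''j'') (var s2 ''i'') (var s2 ''f'') (var s2 ''y'')"
      using s2 by (auto simp: bfs_state_def)
    have rep2: "represents n (arcs E) s'" if "same_graph s s'" "bounded n s'" for s'
      using rep that same_graphD[OF that(1)] by (simp add: represents_def)
    have ok: "adj_ok n (arcs E) (arr s2 ''deg'') (arr s2 ''adj'') (arr s2 ''ix'')"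
      using rep2[OF sg bd2] by (simp add: represents_def)
    show ?thesis
    proof (cases "var s2 ''f'' = 0")
      case True
      have "blocked E ?mt ?r"
        using bfs_blocked[OF b[unfolded True] _ two mok ok] ng True by (simp add: scan_guard_def)
      moreover have "stored n E s2" using rep2[OF sg bd2] mok mt2 by (simp add: stored_def)
      ultimately show ?thesis
        using True mt2 same_graphD(1)[OF sg]
        by (intro run_While_False) (simp_all add: fits_simps bd2)
    next
      case False
      then have f: "var s2 ''f'' = 1" using s2 by (simp add: bfs_state_def)
      define I where "I s' \<longleftrightarrow> bounded n s' \<and> same_graph s s' \<and> arr s' ''q'' = arr s2 ''q'' \<and>
        arr s' ''par'' = arr s2 ''par'' \<and> var s' ''f'' \<le> 1 \<and>
        flip_inv E ?mt (arr s2 ''q'') (var s2 ''l'') ?r (var s' ''j'') (var s' ''f'') (var s' ''y'')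
          (arr s' ''mate'')" for s'
      have "I s2" using sg bd2 bfsD(12)[OF b False] f mok mt2 by (simp add: I_def flip_inv_def)
      then have "run (word n) (While (Equal (Var ''f'') (Const 1)) flip) s2
          (\<lambda>t s'. I s' \<and> \<not> bval (Equal (Var ''f'') (Const 1)) s' \<and>
          t + 60 * (var s' ''j'' + var s' ''f'') \<le>
          60 * (var s2 ''j'' + var s2 ''f'') + 1 + bcost (Equal (Var ''f'') (Const 1)))"
      proof (rule run_While[where I = I])
        fix s' assume I: "I s'"
        show "bfits (word n) (Equal (Var ''f'') (Const 1)) s'"
          using I by (simp add: I_def fits_simps)
        assume "bval (Equal (Var ''f'') (Const 1)) s'"
        then have f': "var s' ''f'' = 1" by simp
        have q': "arr s' ''q'' = arr s2 ''q''" "arr s' ''par'' = arr s2 ''par''"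
          and bd': "bounded n s'" and sg': "same_graph s s'"
          and inv': "flip_inv E ?mt (arr s2 ''q'') (var s2 ''l'') ?r (var s' ''j'') (var s' ''f'')
            (var s' ''y'') (arr s' ''mate'')"
          using I unfolding I_def by blast+
        show "run (word n) flip s' (\<lambda>t s''. I s'' \<and> 1 + bcost (Equal (Var ''f'') (Const 1)) + t +
            60 * (var s'' ''j'' + var s'' ''f'') \<le> 60 * (var s' ''j'' + var s' ''f''))"
          by (rule run_mono[OF run_flip[OF b[folded q'] two bd' f' inv'[folded q']]])
            (use sg' q' in \<open>simp add: I_def\<close>)
      qed
      then show ?thesis
      proof (rule run_mono)
        fix t s'
        assume A: "I s' \<and> \<not> bval (Equal (Var ''f'') (Const 1)) s' \<and>
          t + 60 * (var s' ''j'' + var s' ''f'') \<le>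
          60 * (var s2 ''j'' + var s2 ''f'') + 1 + bcost (Equal (Var ''f'') (Const 1))"
        then have f0: "var s' ''f'' = 0" by (simp add: I_def)
        have "var s2 ''j'' < var s2 ''l''" using bfsD(12)[OF b False] by blast
        then have "var s2 ''j'' \<le> 2 * m" using bfs_bounds(2)[OF b two mok ok] m by simp
        then have "t \<le> 120 * m + 64" using A f by simp
        then have "t \<le> 120 * (m + 1)\<^sup>2 + 4" by (simp add: power2_eq_square)
        moreover have "same_graph s s'" "bounded n s'" "mate_ok E (arr s' ''mate'')"
          "card (pairs (arr s' ''mate'')) = m + (if ?mt ?r = 0 then 1 else 0)"
          "\<forall>u. ?mt ?r = Suc u \<longrightarrow> arr s' ''mate'' u = 0"
          using A f0 m by (auto simp: I_def flip_inv_def)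
        ultimately show "t \<le> 120 * (m + 1)\<^sup>2 + 4 \<and> ?post s'"
          using rep2 same_graphD(1) by (simp add: stored_def)
      qed
    qed
  qed
  \<comment> \<open>All phases together take at most \<open>440 * (m + 1)\<^sup>2 + 45\<close>; this
    inequality absorbs the constant into the factor 500.\<close>
  have "1 \<le> (m + 1)\<^sup>2" by simp
  show ?thesis unfolding search_def run_Seq
  proof (rule run_mono[OF 1], rule run_mono[OF 2], blast)
    fix t1 t2 :: nat and s1 s2
    assume 1: "t1 \<le> 30 \<and> ?st s1 \<and> scan_potential m s1 \<le> 320 * (m + 1)\<^sup>2"
      and 2: "?st s2 \<and> \<not> bval scan_guard s2 \<and>
        t2 + scan_potential m s2 \<le> scan_potential m s1 + 1 + bcost scan_guard"
    have "t2 \<le> 320 * (m + 1)\<^sup>2 + 9" using 1 2 by (simp add: scan_guard_def)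
    show "run (word n) (While (Equal (Var ''f'') (Const 1)) flip) s2
      (\<lambda>t3 s3. 1 + t1 + (1 + t2 + t3) \<le> 500 * (m + 1)\<^sup>2 \<and> ?post s3)"
    proof (rule run_mono[OF 3])
      show "?st s2" "\<not> bval scan_guard s2" using 2 by auto
      fix t3 s3 assume 3: "t3 \<le> 120 * (m + 1)\<^sup>2 + 4 \<and> ?post s3"
      have "1 + t1 + (1 + t2 + t3) \<le> 500 * (m + 1)\<^sup>2"
        using 1 3 \<open>t2 \<le> _\<close> \<open>1 \<le> (m + 1)\<^sup>2\<close> by linarith
      then show "1 + t1 + (1 + t2 + t3) \<le> 500 * (m + 1)\<^sup>2 \<and> ?post s3" using 3 by blast
    qed
  qed
qed

text \<open>The program never reads colours, so a root outside \<open>S\<close> is treated by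
  colouring with \<open>- S\<close> instead.\<close>

lemma run_search:
  assumes st: "stored n E s" and two: "two_coloured n S E" and r: "var s ''r'' < n"
  shows "run (word n) search s (\<lambda>t s'. t \<le> 500 * (card (pairs (arr s ''mate'')) + 1)\<^sup>2 \<and>
    stored n E s' \<and> same_args s s' \<and>
    (arr s' ''mate'' = arr s ''mate'' \<and> blocked E (arr s ''mate'') (var s ''r'') \<or>
     card (pairs (arr s' ''mate'')) =
       card (pairs (arr s ''mate'')) + (if arr s ''mate'' (var s ''r'') = 0 then 1 else 0) \<and>
     (\<forall>u. arr s ''mate'' (var s ''r'') = Suc u \<longrightarrow> arr s' ''mate'' u = 0)))"
proof (cases "var s ''r'' \<in> S")
  case True
  show ?thesis using run_search_aux[OF st two r True refl] .
next
  case False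
  then show ?thesis using run_search_aux[OF st two_coloured_uminus[OF two] r _ refl] by blast
qed

section \<open>Processing an update\<close>

definition extend :: "name \<Rightarrow> com" where
  "extend x = Cond (Equal (Get ''mate'' (Var x)) (Const 0)) (Seq (Assign ''r'' (Var x)) search) Skip"

text \<open>Starting at the mate of \<open>u\<close> makes the root a matched vertex: a successful
  flip keeps the size and leaves \<open>u\<close> free.\<close>

definition release :: com where
  "release = Cond (Less (Const 0) (Get ''mate'' (Var ''u'')))
     (Seq (Assign ''r'' (Minus (Get ''mate'' (Var ''u'')) (Const 1))) search) Skip"

definition unlink :: com where
  "unlink = Cond (Equal (Get ''mate'' (Var ''u'')) (Plus (Var ''v'') (Const 1)))
     (Seq (Write ''mate'' (Var ''u'') (Const 0)) (Write ''mate'' (Var ''v'') (Const 0))) Skip"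

text \<open>\<open>release\<close> precedes \<open>add_arc\<close> because its failure is
  interpreted by the maximality of the matching in the old graph, whereas the searches from the ends
  need the new one. \<open>unlink\<close> comes first in a deletion so that the later searches find
  every matched pair joined by an edge.\<close>

definition process :: com where
  "process =
     Seq (Cond (Equal (Var ''op'') (Const 0))
           (Seq release (Seq (add_arc ''u'' ''v'') (add_arc ''v'' ''u'')))
           (Seq unlink (Seq (remove_arc ''u'' ''v'') (remove_arc ''v'' ''u''))))
         (Seq (extend ''u'') (extend ''v''))"

lemma stored_set_var [simp]:
  "stored n E s \<Longrightarrow> k \<le> n \<Longrightarrow> x \<noteq> ''n'' \<Longrightarrow> stored n E (set_var x k s)"
  by (simp add: stored_def represents_def)

lemma stored_bounded: "stored n E s \<Longrightarrow> bounded n s"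
  by (simp add: stored_def represents_def)

lemma budget: "k \<le> 20 \<Longrightarrow> k \<le> 520 * (Suc m)\<^sup>2"
  "k \<le> 20 \<Longrightarrow> t \<le> 500 * (Suc m)\<^sup>2 \<Longrightarrow> k + t \<le> 520 * (Suc m)\<^sup>2"
proof -
  have "1 \<le> (Suc m)\<^sup>2" by simp
  then show "k \<le> 20 \<Longrightarrow> k \<le> 520 * (Suc m)\<^sup>2"
    "k \<le> 20 \<Longrightarrow> t \<le> 500 * (Suc m)\<^sup>2 \<Longrightarrow> k + t \<le> 520 * (Suc m)\<^sup>2" by linarith+
qed

lemma run_extend:
  assumes st: "stored n E s" and two: "two_coloured n S E" and x: "var s x < n"
  shows "run (word n) (extend x) s (\<lambda>t s'. t \<le> 520 * (card (pairs (arr s ''mate'')) + 1)\<^sup>2 \<and>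
    stored n E s' \<and> same_args s s' \<and>
    (arr s' ''mate'' = arr s ''mate'' \<and>
       (arr s ''mate'' (var s x) = 0 \<longrightarrow> blocked E (arr s ''mate'') (var s x)) \<or>
     card (pairs (arr s' ''mate'')) = Suc (card (pairs (arr s ''mate'')))))"
proof -
  note bd = stored_bounded[OF st]
  let ?s = "set_var ''r'' (var s x) s"
  have st': "stored n E ?s" using st x by simp
  show ?thesis
  proof (cases "arr s ''mate'' (var s x) = 0")
    case True
    have "run (word n) search ?s (\<lambda>t s'. 20 + t \<le> 520 * (card (pairs (arr s ''mate'')) + 1)\<^sup>2 \<and>
      stored n E s' \<and> same_args s s' \<and>
      (arr s' ''mate'' = arr s ''mate'' \<and>
         (arr s ''mate'' (var s x) = 0 \<longrightarrow> blocked E (arr s ''mate'') (var s x)) \<or>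
       card (pairs (arr s' ''mate'')) = Suc (card (pairs (arr s ''mate'')))))"
      by (rule run_mono[OF run_search[OF st' two]])
        (use x True in \<open>auto simp: same_args_def budget\<close>)
    then show ?thesis using True bd
      by (simp add: extend_def run_simps fits_simps) (erule run_mono, auto)
  next
    case False
    then show ?thesis using st bd by (simp add: extend_def run_simps fits_simps same_args_def budget)
  qed
qed

lemma maximum_matching_ge:
  "maximum_matching E M \<Longrightarrow> matching E M' \<Longrightarrow> card M \<le> card M' \<Longrightarrow> maximum_matching E M'"
  unfolding maximum_matching_def by (meson order_trans)

lemma stored_matching: "stored n E s \<Longrightarrow> matching E (pairs (arr s ''mate''))"
  by (simp add: stored_def matching_pairs)

lemma run_release:
  assumes st: "stored n E s" and two: "two_coloured n S (insert {var s ''u'', var s ''v''} E)"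
    and max: "maximum_matching E (pairs (arr s ''mate''))"
  shows "run (word n) release s (\<lambda>t s'. t \<le> 520 * (card (pairs (arr s ''mate'')) + 1)\<^sup>2 \<and>
    stored n E s' \<and> same_args s s' \<and> maximum_matching E (pairs (arr s' ''mate'')) \<and>
    card (pairs (arr s' ''mate'')) = card (pairs (arr s ''mate'')) \<and>
    (arr s' ''mate'' (var s ''u'') = 0 \<or>
     maximum_matching (insert {var s ''u'', var s ''v''} E) (pairs (arr s' ''mate''))))"
    (is "run _ _ _ (\<lambda>t s'. t \<le> ?T \<and> ?post s')")
proof -
  note bd = stored_bounded[OF st]
  let ?u = "var s ''u''" and ?m = "card (pairs (arr s ''mate''))"
  have mok: "mate_ok E (arr s ''mate'')" using st by (simp add: stored_def)
  show ?thesis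
  proof (cases "arr s ''mate'' ?u")
    case 0
    then show ?thesis
      using st bd max by (simp add: release_def run_simps fits_simps same_args_def budget)
  next
    case (Suc p)
    have pu: "{?u, p} \<in> E" "arr s ''mate'' p = Suc ?u" using mate_okD[OF mok Suc] by auto
    have twoE: "two_coloured n S E" using two by (rule two_coloured_mono) auto
    have pn: "p < n" using two_coloured_edge[OF twoE pu(1)] by blast
    then have st': "stored n E (set_var ''r'' p s)" using st by simp
    have "run (word n) search (set_var ''r'' p s) (\<lambda>t s'. 20 + t \<le> ?T \<and> ?post s')"
    proof (rule run_mono[OF run_search[OF st' twoE]])
      show "var (set_var ''r'' p s) ''r'' < n" using pn by simp
      fix t s' assume A: "t \<le> 500 * (card (pairs (arr (set_var ''r'' p s) ''mate'')) + 1)\<^sup>2 \<and>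
        stored n E s' \<and> same_args (set_var ''r'' p s) s' \<and>
        (arr s' ''mate'' = arr (set_var ''r'' p s) ''mate'' \<and>
          blocked E (arr (set_var ''r'' p s) ''mate'') (var (set_var ''r'' p s) ''r'') \<or>
         card (pairs (arr s' ''mate'')) = card (pairs (arr (set_var ''r'' p s) ''mate'')) +
           (if arr (set_var ''r'' p s) ''mate'' (var (set_var ''r'' p s) ''r'') = 0 then 1 else 0) \<and>
         (\<forall>u. arr (set_var ''r'' p s) ''mate'' (var (set_var ''r'' p s) ''r'') = Suc u \<longrightarrow>
           arr s' ''mate'' u = 0))"
      then have c: "card (pairs (arr s' ''mate'')) = ?m" using pu by auto
      have m: "maximum_matching E (pairs (arr s' ''mate''))"
        using maximum_matching_ge[OF max stored_matching[of n]] A c by auto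
      have "arr s' ''mate'' ?u = 0 \<or>
        maximum_matching (insert {var s ''u'', var s ''v''} E) (pairs (arr s' ''mate''))"
        using A pu maximum_insert_blocked_mate[OF two mok max Suc] by auto
      then show "20 + t \<le> ?T \<and> ?post s'" using A c m by (auto simp: same_args_def budget)
    qed
    moreover have "p < word n" "Suc p < word n" using pn by (auto intro: word_less)
    ultimately show ?thesis using Suc bd
      by (simp add: release_def run_simps fits_simps) (erule run_mono, auto)
  qed
qed

text \<open>Two edge sets occur because the lists still describe \<open>E\<close> while the matching
  already avoids the deleted edge. If that edge was not matched, the unchanged matching stays
  maximum.\<close>

lemma run_unlink:
  assumes st: "stored n E s" and two: "two_coloured n S E" and e: "{var s ''u'', var s ''v''} \<in> E"
    and max: "maximum_matching E (pairs (arr s ''mate''))"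
  shows "run (word n) unlink s (\<lambda>t s'. t \<le> 20 \<and> represents n (arcs E) s' \<and> same_args s s' \<and>
    mate_ok (E - {{var s ''u'', var s ''v''}}) (arr s' ''mate'') \<and>
    card (pairs (arr s ''mate'')) \<le> Suc (card (pairs (arr s' ''mate''))) \<and>
    (maximum_matching (E - {{var s ''u'', var s ''v''}}) (pairs (arr s' ''mate'')) \<or>
     arr s' ''mate'' (var s ''u'') = 0 \<and> arr s' ''mate'' (var s ''v'') = 0 \<and>
     card (pairs (arr s ''mate'')) = Suc (card (pairs (arr s' ''mate'')))))"
proof -
  note bd = stored_bounded[OF st]
  let ?u = "var s ''u''" and ?v = "var s ''v''" and ?mt = "arr s ''mate''"
  have mok: "mate_ok E ?mt" and rep: "represents n (arcs E) s" using st by (auto simp: stored_def)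
  note uv = two_coloured_edge[OF two e]
  show ?thesis
  proof (cases "?mt ?u = Suc ?v")
    case True
    note un = mate_unlink[OF mok True uv(4)]
    have "{?u, ?v} \<in> pairs ?mt" using in_pairs_iff[OF mok] True by simp
    with finite_pairs[OF two_coloured_finite[OF two] mok]
    have "card (pairs ?mt) = Suc (card (pairs ?mt - {{?u, ?v}}))" by (rule card.remove)
    moreover have "(?mt(?u := 0, ?v := 0)) ?u = 0" "(?mt(?u := 0, ?v := 0)) ?v = 0" by simp_all
    ultimately show ?thesis using True bd rep un
      by (simp add: unlink_def run_simps fits_simps same_args_def represents_def del: fun_upd_apply)
  next
    case False
    have sub: "pairs ?mt \<subseteq> E - {{?u, ?v}}"
      using False in_pairs_iff[OF mok] stored_matching[OF st] by (auto simp: matching_def)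
    have ok: "mate_ok (E - {{?u, ?v}}) ?mt"
      using mok sub unfolding mate_ok_def pairs_def by blast
    have "maximum_matching (E - {{?u, ?v}}) (pairs ?mt)"
      using maximum_delete[OF max matching_pairs[OF ok] order_refl two_coloured_finite[OF two]] .
    then show ?thesis using False bd rep ok
      by (simp add: unlink_def run_simps fits_simps same_args_def)
  qed
qed

lemma same_argsD: "same_args s s' \<Longrightarrow> x \<in> {''op'', ''u'', ''v''} \<Longrightarrow> var s' x = var s x"
  unfolding same_args_def by blast

lemma stored_feed:
  assumes "represents n D s" "u < n" "v < n"
  shows "represents n D (feed (Insert u v) s)" "represents n D (feed (Delete u v) s)"
  using assms by (auto simp: represents_def)

lemma arcs_insert: "insert (v, u) (insert (u, v) (arcs E)) = arcs (insert {u, v} E)"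
  by (auto simp: doubleton_eq_iff)

lemma arcs_remove: "arcs E - {(u, v)} - {(v, u)} = arcs (E - {{u, v}})"
  by (auto simp: doubleton_eq_iff)

section \<open>Correctness and cost of a whole update\<close>

text \<open>The effect of \<open>extend\<close> on the mate array alone. That failure means an
  unchanged array lets the certificates of two failed searches be combined.\<close>

definition extend_post :: "nat set set \<Rightarrow> nat \<Rightarrow> (nat \<Rightarrow> nat) \<Rightarrow> (nat \<Rightarrow> nat) \<Rightarrow> bool" where
  "extend_post E a mt mt' \<longleftrightarrow> mt' = mt \<and> (mt a = 0 \<longrightarrow> blocked E mt a) \<or>
     card (pairs mt') = Suc (card (pairs mt))"

lemma extend_post_card: "extend_post E a mt mt' \<Longrightarrow> card (pairs mt) \<le> card (pairs mt')"
  by (auto simp: extend_post_def)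

lemma extend_post_maximum:
  "extend_post E a mt mt' \<Longrightarrow> maximum_matching E (pairs mt) \<Longrightarrow> mate_ok E mt' \<Longrightarrow>
     maximum_matching E (pairs mt')"
  using maximum_matching_ge[OF _ matching_pairs] extend_post_card by metis

text \<open>The matching never shrinks here, so both searches can be charged to its final
  size.\<close>

lemma run_extend_both:
  assumes st: "stored n E s" and two: "two_coloured n S E" and uv: "var s ''u'' < n" "var s ''v'' < n"
  shows "run (word n) (Seq (extend ''u'') (extend ''v'')) s (\<lambda>t s'. \<exists>mt.
    t \<le> 1 + 1040 * (card (pairs (arr s' ''mate'')) + 1)\<^sup>2 \<and> stored n E s' \<and> mate_ok E mt \<and>
    extend_post E (var s ''u'') (arr s ''mate'') mt \<and> extend_post E (var s ''v'') mt (arr s' ''mate''))"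
  unfolding run_Seq
proof (rule run_mono[OF run_extend[OF st two uv(1)]])
  fix t1 :: nat and s1
  assume "t1 \<le> 520 * (card (pairs (arr s ''mate'')) + 1)\<^sup>2 \<and> stored n E s1 \<and> same_args s s1 \<and>
    (arr s1 ''mate'' = arr s ''mate'' \<and>
       (arr s ''mate'' (var s ''u'') = 0 \<longrightarrow> blocked E (arr s ''mate'') (var s ''u'')) \<or>
     card (pairs (arr s1 ''mate'')) = Suc (card (pairs (arr s ''mate''))))"
  then have 1: "t1 \<le> 520 * (card (pairs (arr s ''mate'')) + 1)\<^sup>2" "stored n E s1"
    and sa: "same_args s s1" and p1: "extend_post E (var s ''u'') (arr s ''mate'') (arr s1 ''mate'')"
    by (simp_all add: extend_post_def)
  have v: "var s1 ''v'' = var s ''v''" using same_argsD[OF sa] by blast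
  have v1: "var s1 ''v'' < n" using v uv by simp
  show "run (word n) (extend ''v'') s1 (\<lambda>t2 s2. \<exists>mt.
    1 + t1 + t2 \<le> 1 + 1040 * (card (pairs (arr s2 ''mate'')) + 1)\<^sup>2 \<and> stored n E s2 \<and> mate_ok E mt \<and>
    extend_post E (var s ''u'') (arr s ''mate'') mt \<and> extend_post E (var s ''v'') mt (arr s2 ''mate''))"
  proof (rule run_mono[OF run_extend[OF 1(2) two v1]])
    fix t2 :: nat and s2
    assume "t2 \<le> 520 * (card (pairs (arr s1 ''mate'')) + 1)\<^sup>2 \<and> stored n E s2 \<and> same_args s1 s2 \<and>
      (arr s2 ''mate'' = arr s1 ''mate'' \<and>
         (arr s1 ''mate'' (var s1 ''v'') = 0 \<longrightarrow> blocked E (arr s1 ''mate'') (var s1 ''v'')) \<or>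
       card (pairs (arr s2 ''mate'')) = Suc (card (pairs (arr s1 ''mate''))))"
    then have 2: "t2 \<le> 520 * (card (pairs (arr s1 ''mate'')) + 1)\<^sup>2" "stored n E s2"
      and p2: "extend_post E (var s ''v'') (arr s1 ''mate'') (arr s2 ''mate'')"
      by (simp_all add: extend_post_def v)
    have "(card (pairs (arr s ''mate'')) + 1)\<^sup>2 \<le> (card (pairs (arr s2 ''mate'')) + 1)\<^sup>2"
      "(card (pairs (arr s1 ''mate'')) + 1)\<^sup>2 \<le> (card (pairs (arr s2 ''mate'')) + 1)\<^sup>2"
      using extend_post_card[OF p1] extend_post_card[OF p2] by (auto intro: power_mono)
    then have "1 + t1 + t2 \<le> 1 + 1040 * (card (pairs (arr s2 ''mate'')) + 1)\<^sup>2"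
      using 1(1) 2(1) by linarith
    moreover have "mate_ok E (arr s1 ''mate'')" using 1(2) by (simp add: stored_def)
    ultimately show "\<exists>mt. 1 + t1 + t2 \<le> 1 + 1040 * (card (pairs (arr s2 ''mate'')) + 1)\<^sup>2 \<and> stored n E s2 \<and>
      mate_ok E mt \<and> extend_post E (var s ''u'') (arr s ''mate'') mt \<and>
      extend_post E (var s ''v'') mt (arr s2 ''mate'')"
      using 2(2) p1 p2 by blast
  qed
qed

definition processed :: "nat \<Rightarrow> nat set set \<Rightarrow> nat \<Rightarrow> state \<Rightarrow> bool" where
  "processed n E t s \<longleftrightarrow> stored n E s \<and> maximum_matching E (pairs (arr s ''mate'')) \<and>
     t \<le> 2000 * (card (pairs (arr s ''mate'')) + 1)\<^sup>2"

lemma run_process_insert: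
  assumes st: "stored n E s" and op: "var s ''op'' = 0"
    and max: "maximum_matching E (pairs (arr s ''mate''))"
    and new: "{var s ''u'', var s ''v''} \<notin> E"
    and two: "two_coloured n S (insert {var s ''u'', var s ''v''} E)"
  shows "run (word n) process s (processed n (insert {var s ''u'', var s ''v''} E))"
proof -
  let ?u = "var s ''u''" and ?v = "var s ''v''" and ?E = "insert {var s ''u'', var s ''v''} E"
  let ?m = "card (pairs (arr s ''mate''))"
  have uv: "?u < n" "?v < n" "?u \<noteq> ?v" using two_coloured_edge[OF two, of ?u ?v] by auto
  have finE: "finite E" using two_coloured_finite[OF two] by simp
  have 1: "run (word n) (Seq release (Seq (add_arc ''u'' ''v'') (add_arc ''v'' ''u''))) s
    (\<lambda>t s'. t \<le> 520 * (?m + 1)\<^sup>2 + 62 \<and> stored n ?E s' \<and> mate_ok E (arr s' ''mate'') \<and>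
      same_args s s' \<and> maximum_matching E (pairs (arr s' ''mate'')) \<and> card (pairs (arr s' ''mate'')) = ?m \<and>
      (arr s' ''mate'' ?u = 0 \<or> maximum_matching ?E (pairs (arr s' ''mate''))))"
    unfolding run_Seq
  proof (rule run_mono[OF run_release[OF st two max]])
    fix t1 :: nat and s1
    assume 1: "t1 \<le> 520 * (?m + 1)\<^sup>2 \<and> stored n E s1 \<and> same_args s s1 \<and>
      maximum_matching E (pairs (arr s1 ''mate'')) \<and> card (pairs (arr s1 ''mate'')) = ?m \<and>
      (arr s1 ''mate'' ?u = 0 \<or> maximum_matching ?E (pairs (arr s1 ''mate'')))"
    then have v1: "var s1 ''u'' = ?u" "var s1 ''v'' = ?v" and mok: "mate_ok E (arr s1 ''mate'')"
      and rep: "represents n (arcs E) s1"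
      by (auto simp: stored_def same_args_def)
    show "run (word n) (add_arc ''u'' ''v'') s1 (\<lambda>t2 s2. run (word n) (add_arc ''v'' ''u'') s2 (\<lambda>t3 s3.
      1 + t1 + (1 + t2 + t3) \<le> 520 * (?m + 1)\<^sup>2 + 62 \<and> stored n ?E s3 \<and> mate_ok E (arr s3 ''mate'') \<and>
      same_args s s3 \<and> maximum_matching E (pairs (arr s3 ''mate'')) \<and> card (pairs (arr s3 ''mate'')) = ?m \<and>
      (arr s3 ''mate'' ?u = 0 \<or> maximum_matching ?E (pairs (arr s3 ''mate'')))))"
    proof (rule run_mono[OF run_add_arc[OF rep]])
      show "var s1 ''u'' < n" "var s1 ''v'' < n" "(var s1 ''u'', var s1 ''v'') \<notin> arcs E"
        using v1 uv new by auto
      fix t2 :: nat and s2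
      assume "t2 \<le> 30 \<and> represents n (insert (var s1 ''u'', var s1 ''v'') (arcs E)) s2 \<and>
        same_args s1 s2 \<and> arr s2 ''mate'' = arr s1 ''mate''"
      then have 2: "t2 \<le> 30" "represents n (insert (?u, ?v) (arcs E)) s2" "same_args s1 s2"
        "arr s2 ''mate'' = arr s1 ''mate''" using v1 by auto
      have v2: "var s2 ''u'' = ?u" "var s2 ''v'' = ?v" using v1 2(3) by (auto simp: same_args_def)
      show "run (word n) (add_arc ''v'' ''u'') s2 (\<lambda>t3 s3.
        1 + t1 + (1 + t2 + t3) \<le> 520 * (?m + 1)\<^sup>2 + 62 \<and> stored n ?E s3 \<and> mate_ok E (arr s3 ''mate'') \<and>
        same_args s s3 \<and> maximum_matching E (pairs (arr s3 ''mate'')) \<and> card (pairs (arr s3 ''mate'')) = ?m \<and>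
        (arr s3 ''mate'' ?u = 0 \<or> maximum_matching ?E (pairs (arr s3 ''mate''))))"
      proof (rule run_mono[OF run_add_arc[OF 2(2)]])
        show "var s2 ''v'' < n" "var s2 ''u'' < n" "(var s2 ''v'', var s2 ''u'') \<notin> insert (?u, ?v) (arcs E)"
          using v2 uv new by (auto simp: insert_commute)
        fix t3 :: nat and s3
        assume 3: "t3 \<le> 30 \<and> represents n (insert (var s2 ''v'', var s2 ''u'') (insert (?u, ?v) (arcs E))) s3 \<and>
          same_args s2 s3 \<and> arr s3 ''mate'' = arr s2 ''mate''"
        have "represents n (insert (?v, ?u) (insert (?u, ?v) (arcs E))) s3" using 3 v2 by simp
        then have "represents n (arcs ?E) s3" by (simp only: arcs_insert)
        then have "stored n ?E s3"
          using 1 2(4) 3 mate_ok_mono[OF mok, of ?E] by (auto simp: stored_def)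
        moreover have "same_args s s3" using 1 2(3) 3 same_args_trans by blast
        ultimately show "1 + t1 + (1 + t2 + t3) \<le> 520 * (?m + 1)\<^sup>2 + 62 \<and> stored n ?E s3 \<and>
          mate_ok E (arr s3 ''mate'') \<and> same_args s s3 \<and> maximum_matching E (pairs (arr s3 ''mate'')) \<and>
          card (pairs (arr s3 ''mate'')) = ?m \<and>
          (arr s3 ''mate'' ?u = 0 \<or> maximum_matching ?E (pairs (arr s3 ''mate'')))"
          using 1 2 3 mok by simp
      qed
    qed
  qed
  have 2: "run (word n) (Seq (extend ''u'') (extend ''v'')) s1 (\<lambda>t2.
      processed n ?E (1 + (4 + t1) + t2))"
    if A: "t1 \<le> 520 * (?m + 1)\<^sup>2 + 62 \<and> stored n ?E s1 \<and> mate_ok E (arr s1 ''mate'') \<and>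
      same_args s s1 \<and> maximum_matching E (pairs (arr s1 ''mate'')) \<and> card (pairs (arr s1 ''mate'')) = ?m \<and>
      (arr s1 ''mate'' ?u = 0 \<or> maximum_matching ?E (pairs (arr s1 ''mate'')))" for t1 :: nat and s1
  proof -
    let ?mt = "arr s1 ''mate''"
    have v1: "var s1 ''u'' = ?u" "var s1 ''v'' = ?v" using A by (auto simp: same_args_def)
    have st1: "stored n ?E s1" and uv1: "var s1 ''u'' < n" "var s1 ''v'' < n" using A v1 uv by auto
    show ?thesis
    proof (rule run_mono[OF run_extend_both[OF st1 two uv1]])
      fix t2 :: nat and s2
      assume "\<exists>mt. t2 \<le> 1 + 1040 * (card (pairs (arr s2 ''mate'')) + 1)\<^sup>2 \<and> stored n ?E s2 \<and>
        mate_ok ?E mt \<and> extend_post ?E (var s1 ''u'') ?mt mt \<and> extend_post ?E (var s1 ''v'') mt (arr s2 ''mate'')"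
      then obtain mt where t2: "t2 \<le> 1 + 1040 * (card (pairs (arr s2 ''mate'')) + 1)\<^sup>2"
        and st2: "stored n ?E s2" and mok: "mate_ok ?E mt"
        and p: "extend_post ?E ?u ?mt mt" "extend_post ?E ?v mt (arr s2 ''mate'')"
        unfolding v1 by blast
      \<comment> \<open>Either the matching is already maximum in the new graph, as after a failed
        \<open>release\<close>, or \<open>u\<close> is free and its search decides.\<close>
      have "maximum_matching ?E (pairs mt)"
      proof (cases "maximum_matching ?E (pairs ?mt)")
        case True
        then show ?thesis using extend_post_maximum p(1) mok by blast
      next
        case False
        then have u0: "?mt ?u = 0" using A by blast
        from p(1) show ?thesis unfolding extend_post_def
        proof (elim disjE conjE)
          assume "mt = ?mt" "?mt ?u = 0 \<longrightarrow> blocked ?E ?mt ?u"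
          then show ?thesis using maximum_insert_blocked_free[OF two] u0 A by blast
        next
          assume "card (pairs mt) = Suc (card (pairs ?mt))"
          then show ?thesis
            using maximum_insert_larger[OF finE] matching_pairs[OF mok] A by blast
        qed
      qed
      then have "maximum_matching ?E (pairs (arr s2 ''mate''))"
        using extend_post_maximum[OF p(2)] st2 by (simp add: stored_def)
      moreover have "?m \<le> card (pairs (arr s2 ''mate''))"
        using A extend_post_card[OF p(1)] extend_post_card[OF p(2)] by simp
      then have "(?m + 1)\<^sup>2 \<le> (card (pairs (arr s2 ''mate'')) + 1)\<^sup>2" by (intro power_mono) auto
      moreover have "1 \<le> (card (pairs (arr s2 ''mate'')) + 1)\<^sup>2" by simp
      \<comment> \<open>The total is at most 1560 times the final square plus 68: 520 for
        \<open>release\<close>, 1040 for the two searches, the rest for arcs and control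
        flow.\<close>
      ultimately have "1 + (4 + t1) + t2 \<le> 2000 * (card (pairs (arr s2 ''mate'')) + 1)\<^sup>2"
        using t2 A by linarith
      then show "processed n ?E (1 + (4 + t1) + t2) s2"
        using st2 \<open>maximum_matching ?E (pairs (arr s2 ''mate''))\<close> by (simp add: processed_def)
    qed
  qed
  have guard: "bfits (word n) (Equal (Var ''op'') (Const 0)) s" "bval (Equal (Var ''op'') (Const 0)) s"
    "1 + bcost (Equal (Var ''op'') (Const 0)) = 4"
    using op stored_bounded[OF st] by (simp_all add: fits_simps)
  show ?thesis
    unfolding process_def run_Seq[of _ "Cond _ _ _"] run_Cond guard(3) if_P[OF guard(2)]
    by (rule conjI[OF guard(1) run_mono[OF 1 2]])
qed

lemma run_process_delete:
  assumes st: "stored n E s" and op: "var s ''op'' = 1"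
    and max: "maximum_matching E (pairs (arr s ''mate''))"
    and old: "{var s ''u'', var s ''v''} \<in> E" and two: "two_coloured n S E"
  shows "run (word n) process s (processed n (E - {{var s ''u'', var s ''v''}}))"
proof -
  let ?u = "var s ''u''" and ?v = "var s ''v''" and ?E = "E - {{var s ''u'', var s ''v''}}"
  let ?M = "pairs (arr s ''mate'')"
  have two': "two_coloured n S ?E" using two by (rule two_coloured_mono) auto
  have uv: "?u < n" "?v < n" "?u \<noteq> ?v" using two_coloured_edge[OF two old] by auto
  have finE: "finite E" using two_coloured_finite[OF two] .
  have 1: "run (word n) (Seq unlink (Seq (remove_arc ''u'' ''v'') (remove_arc ''v'' ''u''))) s
    (\<lambda>t s'. t \<le> 122 \<and> stored n ?E s' \<and> same_args s s' \<and> (maximum_matching ?E (pairs (arr s' ''mate'')) \<or>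
     arr s' ''mate'' ?u = 0 \<and> arr s' ''mate'' ?v = 0 \<and> card ?M = Suc (card (pairs (arr s' ''mate'')))))"
    unfolding run_Seq
  proof (rule run_mono[OF run_unlink[OF st two old max]])
    fix t1 :: nat and s1
    assume 1: "t1 \<le> 20 \<and> represents n (arcs E) s1 \<and> same_args s s1 \<and> mate_ok ?E (arr s1 ''mate'') \<and>
      card ?M \<le> Suc (card (pairs (arr s1 ''mate''))) \<and> (maximum_matching ?E (pairs (arr s1 ''mate'')) \<or>
      arr s1 ''mate'' ?u = 0 \<and> arr s1 ''mate'' ?v = 0 \<and> card ?M = Suc (card (pairs (arr s1 ''mate''))))"
    then have v1: "var s1 ''u'' = ?u" "var s1 ''v'' = ?v" and rep: "represents n (arcs E) s1"
      by (auto simp: same_args_def)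
    show "run (word n) (remove_arc ''u'' ''v'') s1 (\<lambda>t2 s2. run (word n) (remove_arc ''v'' ''u'') s2 (\<lambda>t3 s3.
      1 + t1 + (1 + t2 + t3) \<le> 122 \<and> stored n ?E s3 \<and> same_args s s3 \<and>
      (maximum_matching ?E (pairs (arr s3 ''mate'')) \<or>
       arr s3 ''mate'' ?u = 0 \<and> arr s3 ''mate'' ?v = 0 \<and> card ?M = Suc (card (pairs (arr s3 ''mate''))))))"
    proof (rule run_mono[OF run_remove_arc[OF rep]])
      show "(var s1 ''u'', var s1 ''v'') \<in> arcs E" using v1 old by simp
      fix t2 :: nat and s2
      assume "t2 \<le> 50 \<and> represents n (arcs E - {(var s1 ''u'', var s1 ''v'')}) s2 \<and>
        same_args s1 s2 \<and> arr s2 ''mate'' = arr s1 ''mate''"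
      then have 2: "t2 \<le> 50" "represents n (arcs E - {(?u, ?v)}) s2" "same_args s1 s2"
        "arr s2 ''mate'' = arr s1 ''mate''" using v1 by auto
      have v2: "var s2 ''u'' = ?u" "var s2 ''v'' = ?v" using v1 2(3) by (auto simp: same_args_def)
      show "run (word n) (remove_arc ''v'' ''u'') s2 (\<lambda>t3 s3.
        1 + t1 + (1 + t2 + t3) \<le> 122 \<and> stored n ?E s3 \<and> same_args s s3 \<and>
        (maximum_matching ?E (pairs (arr s3 ''mate'')) \<or>
         arr s3 ''mate'' ?u = 0 \<and> arr s3 ''mate'' ?v = 0 \<and> card ?M = Suc (card (pairs (arr s3 ''mate'')))))"
      proof (rule run_mono[OF run_remove_arc[OF 2(2)]])
        show "(var s2 ''v'', var s2 ''u'') \<in> arcs E - {(?u, ?v)}"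
          using v2 uv old by (auto simp: insert_commute)
        fix t3 :: nat and s3
        assume 3: "t3 \<le> 50 \<and> represents n (arcs E - {(?u, ?v)} - {(var s2 ''v'', var s2 ''u'')}) s3 \<and>
          same_args s2 s3 \<and> arr s3 ''mate'' = arr s2 ''mate''"
        have "stored n ?E s3" using 1 3 v2 2(4) unfolding stored_def arcs_remove[symmetric] by auto
        moreover have "same_args s s3" using 1 2(3) 3 same_args_trans by blast
        ultimately show "1 + t1 + (1 + t2 + t3) \<le> 122 \<and> stored n ?E s3 \<and> same_args s s3 \<and>
          (maximum_matching ?E (pairs (arr s3 ''mate'')) \<or>
           arr s3 ''mate'' ?u = 0 \<and> arr s3 ''mate'' ?v = 0 \<and> card ?M = Suc (card (pairs (arr s3 ''mate''))))"
          using 1 2 3 by simp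
      qed simp_all
    qed simp_all
  qed
  have 2: "run (word n) (Seq (extend ''u'') (extend ''v'')) s1 (\<lambda>t2.
      processed n ?E (1 + (4 + t1) + t2))"
    if A: "t1 \<le> 122 \<and> stored n ?E s1 \<and> same_args s s1 \<and> (maximum_matching ?E (pairs (arr s1 ''mate'')) \<or>
      arr s1 ''mate'' ?u = 0 \<and> arr s1 ''mate'' ?v = 0 \<and> card ?M = Suc (card (pairs (arr s1 ''mate''))))"
      for t1 :: nat and s1
  proof -
    let ?mt = "arr s1 ''mate''"
    have v1: "var s1 ''u'' = ?u" "var s1 ''v'' = ?v" using A by (auto simp: same_args_def)
    have st1: "stored n ?E s1" and uv1: "var s1 ''u'' < n" "var s1 ''v'' < n" using A v1 uv by auto
    have mok1: "mate_ok ?E ?mt" using st1 by (simp add: stored_def)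
    show ?thesis
    proof (rule run_mono[OF run_extend_both[OF st1 two' uv1]])
      fix t2 :: nat and s2 :: state
      let ?M' = "pairs (arr s2 ''mate'')"
      assume "\<exists>mt. t2 \<le> 1 + 1040 * (card ?M' + 1)\<^sup>2 \<and> stored n ?E s2 \<and>
        mate_ok ?E mt \<and> extend_post ?E (var s1 ''u'') ?mt mt \<and> extend_post ?E (var s1 ''v'') mt (arr s2 ''mate'')"
      then obtain mt where t2: "t2 \<le> 1 + 1040 * (card ?M' + 1)\<^sup>2"
        and st2: "stored n ?E s2" and mok: "mate_ok ?E mt"
        and p: "extend_post ?E ?u ?mt mt" "extend_post ?E ?v mt (arr s2 ''mate'')"
        unfolding v1 by blast
      have mok2: "mate_ok ?E (arr s2 ''mate'')" using st2 by (simp add: stored_def)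
      have "maximum_matching ?E ?M'"
      proof (cases "maximum_matching ?E (pairs ?mt)")
        case True
        then show ?thesis using extend_post_maximum[OF p(2) _ mok2] extend_post_maximum[OF p(1) _ mok] by blast
      next
        case False
        then have free: "?mt ?u = 0" "?mt ?v = 0" and card: "card ?M = Suc (card (pairs ?mt))"
          using A by auto
        \<comment> \<open>A deletion cannot raise the maximum, so regaining the old size is enough.
          Otherwise neither search succeeded, and both certificates concern the same array.\<close>
        show ?thesis
        proof (cases "card ?M \<le> card ?M'")
          case True
          then show ?thesis using maximum_delete[OF max matching_pairs[OF mok2] _ finE] by blast
        next
          case False
          then have "card (pairs mt) \<noteq> Suc (card (pairs ?mt))" "card ?M' \<noteq> Suc (card (pairs mt))"
            using card extend_post_card[OF p(1)] extend_post_card[OF p(2)] by auto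
          then have eq: "mt = ?mt" "arr s2 ''mate'' = ?mt" and bl: "blocked ?E ?mt ?u" "blocked ?E ?mt ?v"
            using p free unfolding extend_post_def by auto
          show ?thesis
            unfolding eq(2) using maximum_delete_blocked[OF two mok1 old max card free bl] .
        qed
      qed
      moreover have "1 \<le> (card ?M' + 1)\<^sup>2" by simp
      then have "1 + (4 + t1) + t2 \<le> 2000 * (card ?M' + 1)\<^sup>2" using t2 A by linarith
      ultimately show "processed n ?E (1 + (4 + t1) + t2) s2" using st2 by (simp add: processed_def)
    qed
  qed
  have guard: "bfits (word n) (Equal (Var ''op'') (Const 0)) s" "\<not> bval (Equal (Var ''op'') (Const 0)) s"
    "1 + bcost (Equal (Var ''op'') (Const 0)) = 4"
    using op stored_bounded[OF st] by (simp_all add: fits_simps)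
  show ?thesis
    unfolding process_def run_Seq[of _ "Cond _ _ _"] run_Cond guard(3) if_not_P[OF guard(2)]
    by (rule conjI[OF guard(1) run_mono[OF 1 2]])
qed

lemma run_process:
  assumes st: "stored n E s" and max: "maximum_matching E (pairs (arr s ''mate''))"
    and two: "two_coloured n S E" and adm: "admissible E w" and two': "two_coloured n S' (apply_update w E)"
  shows "run (word n) process (feed w s) (processed n (apply_update w E))"
proof (cases w)
  case (Insert u v)
  have uv: "u < n" "v < n" using two_coloured_edge[OF two', of u v] Insert by auto
  have "stored n E (feed w s)" using st stored_feed(1)[OF _ uv] Insert by (simp add: stored_def)
  then show ?thesis
    using run_process_insert[of n E "feed w s" S'] max adm two' Insert by simp
next
  case (Delete u v)
  have uv: "u < n" "v < n" using two_coloured_edge[OF two, of u v] adm Delete by auto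
  have "stored n E (feed w s)" using st stored_feed(2)[OF _ uv] Delete by (simp add: stored_def)
  then show ?thesis
    using run_process_delete[of n E "feed w s" S] max adm two Delete by simp
qed

section \<open>From single updates to update sequences\<close>

lemma stored_initial: "stored n {} (initial_state n)"
  by (simp add: stored_def represents_def bounded_def adj_ok_def mate_ok_def initial_state_def)

lemma maximum_matching_empty: "maximum_matching {} {}"
  by (auto simp: maximum_matching_def matching_def)

lemma stores_matching_pairs: "stored n E s \<Longrightarrow> stores_matching n s (pairs (arr s ''mate''))"
  by (simp add: stores_matching_def stored_def in_pairs_iff[where E = E])

lemma graph_after_Suc:
  "i < length us \<Longrightarrow> graph_after (take (Suc i) us) = apply_update (us ! i) (graph_after (take i us))"
  by (simp add: graph_after_def take_Suc_conv_app_nth)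

theorem theorem1p8:
  shows "\<exists>(c :: com) (C :: nat) (k :: nat). \<forall>(n :: nat) (us :: update list).
    bipartite_updates n us \<longrightarrow>
      maintains_maximum_matching ((n + 2) ^ k) c n us (\<lambda>m. C * max 1 (m\<^sup>2))"
proof (intro exI allI impI)
  fix n us
  assume us: "bipartite_updates n us"
  let ?G = "\<lambda>i. graph_after (take i us)"
  \<comment> \<open>The states come from dependent choice over all natural numbers; the conditions
    on \<open>i\<close> make \<open>P\<close> and \<open>R\<close> vacuous past the end of
    \<open>us\<close>.\<close>
  define P where "P i s \<longleftrightarrow> (i = 0 \<longrightarrow> s = initial_state n) \<and> (i \<le> length us \<longrightarrow>
    stored n (?G i) s \<and> maximum_matching (?G i) (pairs (arr s ''mate'')))" for i s
  define R where "R i s s' \<longleftrightarrow> (i < length us \<longrightarrow>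
    (\<exists>t. exec (word n) process (feed (us ! i) s) t s' \<and> processed n (?G (Suc i)) t s'))" for i s s'
  have two: "\<exists>S. two_coloured n S (?G i)" if "i \<le> length us" for i
  proof (cases i)
    case 0
    then show ?thesis by (simp add: graph_after_def two_coloured_def)
  next
    case (Suc j)
    then show ?thesis using us that bipartite_two_coloured unfolding bipartite_updates_def by auto
  qed
  have "\<exists>s'. P (Suc i) s' \<and> R i s s'" if P: "P i s" for i s
  proof (cases "i < length us")
    case True
    obtain S S' where S: "two_coloured n S (?G i)" "two_coloured n S' (?G (Suc i))"
      using two[of i] two[of "Suc i"] True by auto
    have adm: "admissible (?G i) (us ! i)" using us True by (simp add: bipartite_updates_def)
    have "stored n (?G i) s" "maximum_matching (?G i) (pairs (arr s ''mate''))"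
      using P True by (auto simp: P_def)
    from run_process[OF this S(1) adm S(2)[unfolded graph_after_Suc[OF True]]]
    obtain t s' where "exec (word n) process (feed (us ! i) s) t s'" "processed n (?G (Suc i)) t s'"
      unfolding run_def graph_after_Suc[OF True] by blast
    then show ?thesis using True by (auto simp: P_def R_def processed_def)
  qed (simp add: P_def R_def)
  moreover have "P 0 (initial_state n)"
  proof -
    have "pairs (arr (initial_state n) ''mate'') = {}" by (simp add: pairs_def initial_state_def)
    then show ?thesis
      using stored_initial[of n] maximum_matching_empty by (simp add: P_def graph_after_def)
  qed
  ultimately obtain s where s: "\<And>i. P i (s i)" "\<And>i. R i (s i) (s (Suc i))"
    using dependent_nat_choice[of P R] by blast
  then have "\<forall>i. \<exists>t. i < length us \<longrightarrow>
      exec (word n) process (feed (us ! i) (s i)) t (s (Suc i)) \<and> processed n (?G (Suc i)) t (s (Suc i))"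
    unfolding R_def by blast
  then obtain t where t: "\<And>i. i < length us \<Longrightarrow>
      exec (word n) process (feed (us ! i) (s i)) (t i) (s (Suc i)) \<and>
      processed n (?G (Suc i)) (t i) (s (Suc i))"
    by metis
  \<comment> \<open>For positive \<open>m\<close> this is \<open>m + 1 \<le> 2 * m\<close> squared;
    for \<open>m = 0\<close> the \<open>max\<close> provides the constant.\<close>
  have sq: "(m + 1)\<^sup>2 \<le> 4 * max 1 (m\<^sup>2)" for m :: nat
  proof (cases "m = 0")
    case False
    then have "(m + 1)\<^sup>2 \<le> (2 * m)\<^sup>2" by (intro power_mono) auto
    then show ?thesis by (simp add: power_mult_distrib max_def)
  qed simp
  \<comment> \<open>The exponent 2 is that of \<open>word\<close>, and 8000 is the 2000 of
    \<open>processed\<close> times the 4 of \<open>sq\<close>.\<close>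
  show "maintains_maximum_matching ((n + 2) ^ 2) process n us (\<lambda>m. 8000 * max 1 (m\<^sup>2))"
    unfolding maintains_maximum_matching_def
  proof (intro exI conjI allI impI)
    show "s 0 = initial_state n" using s(1)[of 0] by (simp add: P_def)
    fix i
    show "stores_matching n (s i) (pairs (arr (s i) ''mate''))"
      "maximum_matching (?G i) (pairs (arr (s i) ''mate''))" if "i \<le> length us"
      using s(1)[of i] that stores_matching_pairs by (auto simp: P_def)
    assume i: "i < length us"
    show "exec ((n + 2)\<^sup>2) process (feed (us ! i) (s i)) (t i) (s (Suc i))"
      using t[OF i] by (simp add: word_def)
    have "t i \<le> 2000 * (card (pairs (arr (s (Suc i)) ''mate'')) + 1)\<^sup>2"
      using t[OF i] unfolding processed_def by blast
    also have "\<dots> \<le> 2000 * (4 * max 1 ((card (pairs (arr (s (Suc i)) ''mate'')))\<^sup>2))"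
      by (rule mult_le_mono2[OF sq])
    finally show "t i \<le> 8000 * max 1 ((card (pairs (arr (s (Suc i)) ''mate'')))\<^sup>2)" by simp
  qed
qed

end
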